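(* Let $E_J$ be a $W$-graph ideal for the weighted Coxeter system $(W,S,L)$, let $x,y\in E_J$ and $\gamma\in\Gamma''$. Put $\Psi=\bigcup_{k\leqslant\ell(y)-\ell(x)}\mathscr{J}_k(x,y)$ and $\Upsilon=\bigcup_{k\leqslant\ell(y)-\ell(x)}\mathscr{M}_k(x,y)$. (1) If $x<y$, then $[q^\gamma](Q_{x,y})=[q^\gamma]\Big(L_{\frac{L(y)-L(x)}2}\Big(\sum_{\varphi\in\Psi}\widetilde{\mathscr{R}}^*_\varphi\Big)\Big)$. (2) If $x\leqslant y$, then $[q^\gamma](Q_{x,y})=[q^\gamma]\Big(\sum_{\varphi\in\Upsilon}\widetilde{\mathscr{R}}^*_\varphi\Big)$.
   Context: Setting. $(W,S)$ is a Coxeter system with length function $\ell$ and Bruhat order $\leqslant$; $\epsilon_w=(-1)^{\ell(w)}$. $\Gamma$ is a totally ordered abelian group (written additively). $\mathbb{Z}[\Gamma]$ is its group ring with $\mathbb{Z}$-basis $\{q^\gamma\mid\gamma\in\Gamma\}$, $q^\gamma q^\zeta=q^{\gamma+\zeta}$; $[q^\gamma](f)$ is the coefficient of $q^\gamma$ in $f$; $\mathsf{deg}(f)$ is the largest $\gamma$ with $[q^\gamma](f)\neq0$, $\mathsf{deg}(0)=-\infty$. The bar is the ring automorphism $q^\gamma\mapsto q^{-\gamma}$. $L:W\to\Gamma$ is a weight: $L(w)=L(s_1)+\cdots+L(s_k)$ for every reduced word $w=s_1\cdots s_k$, and $L(s)\geqslant0$ for all $s\in S$. Put $q_w=q^{L(w)}$.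 $\Gamma''=\{\sum n_iL(s_i)\mid s_i\in S,n_i\in\mathbb{Z}\}$ (finite sums). $\mathscr{H}$ is the Hecke algebra over $\mathbb{Z}[\Gamma]$ with basis $\{T_w\}_{w\in W}$, $T_sT_w=T_{sw}$ if $\ell(sw)>\ell(w)$, $T_sT_w=q_sT_{sw}+(q_s-1)T_w$ if $\ell(sw)<\ell(w)$, with bar involution (semilinear ring involution) $\overline{T_s}=q_s^{-1}T_s+(q_s^{-1}-1)$. $W$-graph ideal. $x$ is a suffix of $y$ ($x\leqslant_L y$) if $y=zx$ with $\ell(y)=\ell(z)+\ell(x)$. Let $E\subseteq W$ be an ideal of $(W,\leqslant_L)$, i.e. every suffix of an element of $E$ is in $E$. For $J\subseteq S$, $D_J=\{w\mid\ell(ws)>\ell(w)\ \forall s\in J\}$. Let $J\subseteq\{s\in S\mid\ell(xs)>\ell(x)\ \forall x\in E\}$, so $E\subseteq D_J$; write $E_J$ for $E$ with this $J$. For $y\in E_J$: $SD(y)=\{s\mid\ell(sy)<\ell(y)\}$, $SA(y)=\{s\mid\ell(sy)>\ell(y),sy\in E_J\}$, $WD(y)=\{s\mid\ell(sy)>\ell(y),sy\notin D_J\}$, $WA(y)=\{s\mid\ell(sy)>\ell(y),sy\in D_J\setminus E_J\}$. $E_J$ is a $W$-graph ideal if there is an $\mathscr{H}$-module $M(E_J,L)$, free over $\mathbb{Z}[\Gamma]$ with basis $\{\Gamma_y\mid y\in E_J\}$, such that $T_s\Gamma_y$ equals $q_s\Gamma_{sy}+(q_s-1)\Gamma_y$ if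 $s\in SD(y)$; $\Gamma_{sy}$ if $s\in SA(y)$; $-\Gamma_y$ if $s\in WD(y)$; $q_s\Gamma_y-\sum_{z<sy,\,z\in E_J}r^s_{z,y}\Gamma_z$ if $s\in WA(y)$, for some $r^s_{z,y}\in q_s\mathbb{Z}[\Gamma]$; and $M(E_J,L)$ admits a $\mathbb{Z}[\Gamma]$-semilinear involution $m\mapsto\overline m$ with $\overline{\Gamma_1}=\Gamma_1$ and $\overline{T_w\Gamma_y}=\overline{T_w}\,\overline{\Gamma_y}$ for all $w\in W,y\in E_J$. Fix such a module. $R$-polynomials. $R_{x,y}\in\mathbb{Z}[\Gamma]$ ($x,y\in E_J$) are defined by $\overline{\Gamma_y}=\sum_{x\in E_J}\epsilon_x\epsilon_yq_y^{-1}R_{x,y}\Gamma_x$. Standing facts: $R_{x,y}=0$ if $x\not\leqslant y$, $R_{x,x}=1$, and for $x\leqslant y$ all exponents $\gamma$ occurring in $R_{x,y}$ lie in $\Gamma''$ and satisfy $0\leqslant\gamma\leqslant L(y)-L(x)$. The dual $R$-polynomials $\widetilde R_{x,y}$ are determined by $\overline{R_{x,y}}=\epsilon_x\epsilon_yq_xq_y^{-1}\widetilde R_{x,y}$. Kazhdan–Lusztig polynomials. $P_{x,y}\in\mathbb{Z}[\Gamma]$ ($x,y\in E_J$) is the unique family with $P_{x,y}=0$ if $x\not\leqslant y$, $P_{x,x}=1$, $\mathsf{deg}(P_{x,y})<\frac{L(y)-L(x)}2$ for $x<y$, and $q_x^{-1}q_y\overline{P_{x,y}}=\sum_{x\leqslant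 t\leqslant y,\,t\in E_J}R_{x,t}P_{t,y}$. The inverse weighted Kazhdan–Lusztig polynomials $Q_{x,y}$ ($x,y\in E_J$) are given recursively by $Q_{x,y}=0$ if $x\not\leqslant y$ and $\sum_{x\leqslant t\leqslant y,\,t\in E_J}\epsilon_t\epsilon_yQ_{x,t}P_{t,y}=\delta_{x,y}$. Truncations. $U_\zeta(\sum_\gamma a_\gamma q^\gamma)=\sum_{\gamma>\zeta}a_\gamma q^\gamma$, $L_\zeta(\sum_\gamma a_\gamma q^\gamma)=\sum_{\gamma<\zeta}a_\gamma q^\gamma$. Halves are taken in the divisible hull of $\Gamma$: $\gamma>\zeta/2$ means $2\gamma>\zeta$. Chains. For $k\geqslant0$, $\mathscr{J}_k(x,y)$ is the set of $E_J$-chains $x=x_0<x_1<\cdots<x_{k+1}=y$ with all $x_i\in E_J$ and $\mathscr{M}_k(x,y)$ the set of $E_J$-multichains $x=x_0\leqslant x_1\leqslant\cdots\leqslant x_{k+1}=y$ with all $x_i\in E_J$ (Bruhat order). $\widetilde{\mathscr{R}}^*$-polynomials. For a multichain $\varphi:x=x_0\leqslant x_1\leqslant\cdots\leqslant x_{r+1}=y$, define recursively $\widetilde{\mathscr{R}}^*_\varphi=\widetilde{\mathscr{R}}^*_{x,y}:=q_x^{-1}q_y\overline{\widetilde R_{x,y}}$ if $r=0$, and $\widetilde{\mathscr{R}}^*_\varphi=U_{\frac{L(x_r)-L(x)}2}\big(q_x^{-1}q_{x_r}\overline{\widetilde{\mathscr{R}}^*_{\varphi'}}\big)\,\widetilde{\mathscr{R}}^*_{x_r,y}$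 if $r\geqslant1$, where $\varphi':x=x_0\leqslant x_1\leqslant\cdots\leqslant x_r$. *)

theory Defs
  imports
    "HOL-Library.Poly_Mapping"
    "HOL-Algebra.Multiplicative_Group"
    "HOL-Algebra.Generated_Groups"
begin

section \<open>Coxeter systems\<close>

definition word_prod :: "('w, 'b) monoid_scheme \<Rightarrow> 'w list \<Rightarrow> 'w" where
  "word_prod W ws = foldr (\<lambda>a b. a \<otimes>\<^bsub>W\<^esub> b) ws \<one>\<^bsub>W\<^esub>"

text \<open>Here \<open>m(s,t)\<close> is the order of \<open>s t\<close>.  \<^const>\<open>group.ord\<close> is \<open>0\<close> on elements of infinite
  order, so that the relator is then the empty word.\<close>

definition relator :: "('w, 'b) monoid_scheme \<Rightarrow> 'w \<Rightarrow> 'w \<Rightarrow> 'w list" where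
  "relator W s t = concat (replicate (group.ord W (s \<otimes>\<^bsub>W\<^esub> t)) [s, t])"

text \<open>The congruence on words in \<open>S\<close> generated by \<open>(s t)\<^sup>m\<^sup>(\<^sup>s\<^sup>,\<^sup>t\<^sup>) \<sim> 1\<close>.  As the relators
  \<open>s s\<close> are included, words without formal inverses suffice to describe the group presented by
  these relations.\<close>

inductive word_equiv :: "('w, 'b) monoid_scheme \<Rightarrow> 'w set \<Rightarrow> 'w list \<Rightarrow> 'w list \<Rightarrow> bool"
  for W :: "('w, 'b) monoid_scheme" and S :: "'w set"
where
  refl: "word_equiv W S u u"
| sym: "word_equiv W S u v \<Longrightarrow> word_equiv W S v u"
| trans: "word_equiv W S u v \<Longrightarrow> word_equiv W S v w \<Longrightarrow> word_equiv W S u w"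
| relator: "u \<in> lists S \<Longrightarrow> v \<in> lists S \<Longrightarrow> s \<in> S \<Longrightarrow> t \<in> S \<Longrightarrow>
    word_equiv W S (u @ relator W s t @ v) (u @ v)"

text \<open>\<open>W\<close> is the group with generating set \<open>S\<close> of involutions presented by
  \<open>(s t)\<^sup>m\<^sup>(\<^sup>s\<^sup>,\<^sup>t\<^sup>) = 1\<close> for \<open>m(s,t) < \<infinity>\<close>.  \<open>S\<close> may be infinite.\<close>

locale coxeter_system = group W for W :: "('w, 'b) monoid_scheme" (structure) +
  fixes S :: "'w set"
  assumes S_carrier: "S \<subseteq> carrier W"
    and S_involution: "s \<in> S \<Longrightarrow> s \<noteq> \<one>" "s \<in> S \<Longrightarrow> s \<otimes> s = \<one>"
    and S_generates: "generate W S = carrier W"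
    and S_presentation: "ws \<in> lists S \<Longrightarrow> word_prod W ws = \<one> \<Longrightarrow> word_equiv W S ws []"

definition len :: "('w, 'b) monoid_scheme \<Rightarrow> 'w set \<Rightarrow> 'w \<Rightarrow> nat" where
  "len W S w = (LEAST n. \<exists>ws\<in>lists S. length ws = n \<and> word_prod W ws = w)"

definition reflections :: "('w, 'b) monoid_scheme \<Rightarrow> 'w set \<Rightarrow> 'w set" where
  "reflections W S = {w \<otimes>\<^bsub>W\<^esub> s \<otimes>\<^bsub>W\<^esub> inv\<^bsub>W\<^esub> w | w s. w \<in> carrier W \<and> s \<in> S}"

definition bruhat_step :: "('w, 'b) monoid_scheme \<Rightarrow> 'w set \<Rightarrow> 'w \<Rightarrow> 'w \<Rightarrow> bool" where
  "bruhat_step W S x y \<longleftrightarrow> x \<in> carrier W \<and> len W S x < len W S y \<and>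
     (\<exists>t\<in>reflections W S. y = x \<otimes>\<^bsub>W\<^esub> t)"

definition bruhat_le :: "('w, 'b) monoid_scheme \<Rightarrow> 'w set \<Rightarrow> 'w \<Rightarrow> 'w \<Rightarrow> bool" where
  "bruhat_le W S = (bruhat_step W S)\<^sup>*\<^sup>*"

definition bruhat_less :: "('w, 'b) monoid_scheme \<Rightarrow> 'w set \<Rightarrow> 'w \<Rightarrow> 'w \<Rightarrow> bool" where
  "bruhat_less W S x y \<longleftrightarrow> bruhat_le W S x y \<and> x \<noteq> y"

definition suffix_le :: "('w, 'b) monoid_scheme \<Rightarrow> 'w set \<Rightarrow> 'w \<Rightarrow> 'w \<Rightarrow> bool" where
  "suffix_le W S x y \<longleftrightarrow>
     (\<exists>z\<in>carrier W. y = z \<otimes>\<^bsub>W\<^esub> x \<and> len W S y = len W S z + len W S x)"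


section \<open>The group ring of the totally ordered abelian group\<close>

text \<open>\<open>\<int>[\<Gamma>]\<close> is \<^typ>\<open>'g \<Rightarrow>\<^sub>0 int\<close> with its convolution product; \<open>[q\<^sup>\<gamma>](f)\<close> is
  \<open>Poly_Mapping.lookup f \<gamma>\<close>.\<close>

type_synonym 'g group_ring = "'g \<Rightarrow>\<^sub>0 int"

definition qpow :: "'g \<Rightarrow> 'g group_ring" where
  "qpow \<gamma> = Poly_Mapping.single \<gamma> 1"

definition bar :: "'g::linordered_ab_group_add group_ring \<Rightarrow> 'g group_ring" where
  "bar f = Poly_Mapping.map_key uminus f"

text \<open>Halves are taken in the divisible hull of \<open>\<Gamma>\<close>: \<open>\<gamma> < \<zeta>/2\<close> means \<open>\<gamma> + \<gamma> < \<zeta>\<close>.  The next three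
  definitions take \<open>\<zeta>\<close> as argument for the bound \<open>\<zeta>/2\<close>.\<close>

definition upper_half :: "'g::linordered_ab_group_add \<Rightarrow> 'g group_ring \<Rightarrow> 'g group_ring" where
  "upper_half \<zeta> f =
     (\<Sum>\<gamma>\<in>{\<gamma>\<in>Poly_Mapping.keys f. \<gamma> + \<gamma> > \<zeta>}. Poly_Mapping.single \<gamma> (Poly_Mapping.lookup f \<gamma>))"

definition lower_half :: "'g::linordered_ab_group_add \<Rightarrow> 'g group_ring \<Rightarrow> 'g group_ring" where
  "lower_half \<zeta> f =
     (\<Sum>\<gamma>\<in>{\<gamma>\<in>Poly_Mapping.keys f. \<gamma> + \<gamma> < \<zeta>}. Poly_Mapping.single \<gamma> (Poly_Mapping.lookup f \<gamma>))"

text \<open>The degree of \<open>0\<close> is \<open>-\<infinity>\<close>, which lies below every bound.\<close>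

definition top_degree :: "'g::linordered_ab_group_add group_ring \<Rightarrow> 'g" where
  "top_degree f = Max (Poly_Mapping.keys f)"

definition degree_less_half :: "'g::linordered_ab_group_add group_ring \<Rightarrow> 'g \<Rightarrow> bool" where
  "degree_less_half f \<zeta> \<longleftrightarrow> f = 0 \<or> top_degree f + top_degree f < \<zeta>"

definition semilinear_involution ::
  "('g::linordered_ab_group_add group_ring \<Rightarrow> 'm::ab_group_add \<Rightarrow> 'm) \<Rightarrow> ('m \<Rightarrow> 'm) \<Rightarrow> bool" where
  "semilinear_involution scale f \<longleftrightarrow>
     (\<forall>m n. f (m + n) = f m + f n) \<and>
     (\<forall>a m. f (scale a m) = scale (bar a) (f m)) \<and>
     (\<forall>m. f (f m) = m)"

definition is_basis ::
  "('r::comm_ring_1 \<Rightarrow> 'm::ab_group_add \<Rightarrow> 'm) \<Rightarrow> 'i set \<Rightarrow> ('i \<Rightarrow> 'm) \<Rightarrow> bool" where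
  "is_basis scale I b \<longleftrightarrow> inj_on b I \<and> \<not> module.dependent scale (b ` I) \<and>
     module.span scale (b ` I) = UNIV"


section \<open>Weights and Hecke algebras\<close>

locale weighted_coxeter_system = coxeter_system W S
  for W :: "('w, 'b) monoid_scheme" (structure) and S :: "'w set" +
  fixes L :: "'w \<Rightarrow> 'g::linordered_ab_group_add"
  assumes L_reduced: "ws \<in> lists S \<Longrightarrow> length ws = len W S (word_prod W ws) \<Longrightarrow>
        L (word_prod W ws) = sum_list (map L ws)"
    and L_nonneg: "s \<in> S \<Longrightarrow> 0 \<le> L s"

definition int_mult :: "int \<Rightarrow> 'g::linordered_ab_group_add \<Rightarrow> 'g" where
  "int_mult n \<gamma> = (\<Sum>i<nat n. \<gamma>) - (\<Sum>i<nat (- n). \<gamma>)"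

definition weight_lattice :: "'w set \<Rightarrow> ('w \<Rightarrow> 'g::linordered_ab_group_add) \<Rightarrow> 'g set" where
  "weight_lattice S L = {\<Sum>s\<in>F. int_mult (n s) (L s) | F n. finite F \<and> F \<subseteq> S}"

locale hecke_algebra = weighted_coxeter_system W S L + H: Modules.module scaleH
  for W :: "('w, 'b) monoid_scheme" (structure) and S :: "'w set"
    and L :: "'w \<Rightarrow> 'g::linordered_ab_group_add"
    and scaleH :: "'g group_ring \<Rightarrow> 'h::ring_1 \<Rightarrow> 'h" +
  fixes T :: "'w \<Rightarrow> 'h"
    and barH :: "'h \<Rightarrow> 'h"
  assumes scale_mult: "scaleH a (h * k) = scaleH a h * k" "scaleH a (h * k) = h * scaleH a k"
    and T_basis: "is_basis scaleH (carrier W) T"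
    and T_one: "T \<one> = 1"
    and T_mult_up: "s \<in> S \<Longrightarrow> w \<in> carrier W \<Longrightarrow> len W S (s \<otimes> w) > len W S w \<Longrightarrow>
        T s * T w = T (s \<otimes> w)"
    and T_mult_down: "s \<in> S \<Longrightarrow> w \<in> carrier W \<Longrightarrow> len W S (s \<otimes> w) < len W S w \<Longrightarrow>
        T s * T w = scaleH (qpow (L s)) (T (s \<otimes> w)) + scaleH (qpow (L s) - 1) (T w)"
    and barH_semilinear: "semilinear_involution scaleH barH"
    and barH_mult: "barH (h * k) = barH h * barH k"
    and barH_one: "barH 1 = 1"
    and barH_T: "s \<in> S \<Longrightarrow>
        barH (T s) = scaleH (qpow (- L s)) (T s) + scaleH (qpow (- L s) - 1) 1"


section \<open>\<open>W\<close>-graph ideals\<close>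

definition suffix_ideal :: "('w, 'b) monoid_scheme \<Rightarrow> 'w set \<Rightarrow> 'w set \<Rightarrow> bool" where
  "suffix_ideal W S E \<longleftrightarrow> E \<subseteq> carrier W \<and>
     (\<forall>y\<in>E. \<forall>x\<in>carrier W. suffix_le W S x y \<longrightarrow> x \<in> E)"

definition D_set :: "('w, 'b) monoid_scheme \<Rightarrow> 'w set \<Rightarrow> 'w set \<Rightarrow> 'w set" where
  "D_set W S J = {w \<in> carrier W. \<forall>s\<in>J. len W S (w \<otimes>\<^bsub>W\<^esub> s) > len W S w}"

definition strong_desc :: "('w, 'b) monoid_scheme \<Rightarrow> 'w set \<Rightarrow> 'w \<Rightarrow> 'w set" where
  "strong_desc W S y = {s \<in> S. len W S (s \<otimes>\<^bsub>W\<^esub> y) < len W S y}"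

definition strong_asc :: "('w, 'b) monoid_scheme \<Rightarrow> 'w set \<Rightarrow> 'w set \<Rightarrow> 'w \<Rightarrow> 'w set" where
  "strong_asc W S E y = {s \<in> S. len W S (s \<otimes>\<^bsub>W\<^esub> y) > len W S y \<and> s \<otimes>\<^bsub>W\<^esub> y \<in> E}"

definition weak_desc :: "('w, 'b) monoid_scheme \<Rightarrow> 'w set \<Rightarrow> 'w set \<Rightarrow> 'w \<Rightarrow> 'w set" where
  "weak_desc W S J y = {s \<in> S. len W S (s \<otimes>\<^bsub>W\<^esub> y) > len W S y \<and> s \<otimes>\<^bsub>W\<^esub> y \<notin> D_set W S J}"

definition weak_asc ::
  "('w, 'b) monoid_scheme \<Rightarrow> 'w set \<Rightarrow> 'w set \<Rightarrow> 'w set \<Rightarrow> 'w \<Rightarrow> 'w set" where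
  "weak_asc W S J E y =
     {s \<in> S. len W S (s \<otimes>\<^bsub>W\<^esub> y) > len W S y \<and> s \<otimes>\<^bsub>W\<^esub> y \<in> D_set W S J - E}"

text \<open>\<open>E\<close> is a \<open>W\<close>-graph ideal with respect to \<open>J\<close> precisely when such a module exists; \<open>act\<close> is the
  action of the Hecke algebra, \<open>G\<close> the basis \<open>\<Gamma>\<^sub>y\<close>.  As \<open>\<Gamma>\<close> is a group, \<open>q\<^sub>s\<close> is a unit of
  \<open>\<int>[\<Gamma>]\<close>, so \<open>r \<in> q\<^sub>s\<int>[\<Gamma>]\<close> is in fact no restriction on the coefficients \<open>r\<close>.\<close>

locale wgraph_ideal_module =
  hecke_algebra W S L scaleH T barH + M: Modules.module scaleM
  for W :: "('w, 'b) monoid_scheme" (structure) and S :: "'w set"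
    and L :: "'w \<Rightarrow> 'g::linordered_ab_group_add"
    and scaleH :: "'g group_ring \<Rightarrow> 'h::ring_1 \<Rightarrow> 'h"
    and T :: "'w \<Rightarrow> 'h" and barH :: "'h \<Rightarrow> 'h"
    and scaleM :: "'g group_ring \<Rightarrow> 'm::ab_group_add \<Rightarrow> 'm" +
  fixes E J :: "'w set"
    and act :: "'h \<Rightarrow> 'm \<Rightarrow> 'm"
    and G :: "'w \<Rightarrow> 'm"
    and barM :: "'m \<Rightarrow> 'm"
  assumes E_ideal: "suffix_ideal W S E"
    and J_subset: "J \<subseteq> {s \<in> S. \<forall>x\<in>E. len W S (x \<otimes> s) > len W S x}"
    and act_add_left: "act (h + k) m = act h m + act k m"
    and act_add_right: "act h (m + n) = act h m + act h n"
    and act_mult: "act (h * k) m = act h (act k m)"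
    and act_one: "act 1 m = m"
    and act_scale: "act (scaleH a h) m = scaleM a (act h m)" "act h (scaleM a m) = scaleM a (act h m)"
    and G_basis: "is_basis scaleM E G"
    and act_SD: "y \<in> E \<Longrightarrow> s \<in> strong_desc W S y \<Longrightarrow>
        act (T s) (G y) = scaleM (qpow (L s)) (G (s \<otimes> y)) + scaleM (qpow (L s) - 1) (G y)"
    and act_SA: "y \<in> E \<Longrightarrow> s \<in> strong_asc W S E y \<Longrightarrow> act (T s) (G y) = G (s \<otimes> y)"
    and act_WD: "y \<in> E \<Longrightarrow> s \<in> weak_desc W S J y \<Longrightarrow> act (T s) (G y) = - G y"
    and act_WA: "y \<in> E \<Longrightarrow> s \<in> weak_asc W S J E y \<Longrightarrow>
        \<exists>r. (\<forall>z. r z \<in> range (\<lambda>c. qpow (L s) * c)) \<and>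
          act (T s) (G y) = scaleM (qpow (L s)) (G y) -
            (\<Sum>z\<in>{z\<in>E. bruhat_less W S z (s \<otimes> y)}. scaleM (r z) (G z))"
    and barM_semilinear: "semilinear_involution scaleM barM"
    and barM_one: "barM (G \<one>) = G \<one>"
    and barM_act: "w \<in> carrier W \<Longrightarrow> y \<in> E \<Longrightarrow>
        barM (act (T w) (G y)) = act (barH (T w)) (barM (G y))"


section \<open>\<open>R\<close>-polynomials and Kazhdan--Lusztig polynomials\<close>

definition eps :: "('w, 'b) monoid_scheme \<Rightarrow> 'w set \<Rightarrow> 'w \<Rightarrow> 'g::linordered_ab_group_add group_ring"
  where "eps W S w = (- 1) ^ len W S w"

text \<open>The coefficient of \<open>\<Gamma>\<^sub>x\<close> in the bar conjugate of \<open>\<Gamma>\<^sub>y\<close> is \<open>\<epsilon>\<^sub>x \<epsilon>\<^sub>y q\<^sub>y\<^sup>-\<^sup>1 R\<^bsub>x,y\<^esub>\<close>; the definition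
  is this equation solved for \<open>R\<^bsub>x,y\<^esub>\<close>, see \<open>bar_G_eq\<close> below.  Likewise for the dual
  polynomials, see \<open>bar_R_eq\<close>.\<close>

definition R_poly ::
  "('w, 'b) monoid_scheme \<Rightarrow> 'w set \<Rightarrow> ('w \<Rightarrow> 'g::linordered_ab_group_add) \<Rightarrow>
   ('g group_ring \<Rightarrow> 'm::ab_group_add \<Rightarrow> 'm) \<Rightarrow> 'w set \<Rightarrow> ('w \<Rightarrow> 'm) \<Rightarrow> ('m \<Rightarrow> 'm) \<Rightarrow>
   'w \<Rightarrow> 'w \<Rightarrow> 'g group_ring" where
  "R_poly W S L scaleM E G barM x y =
     eps W S x * eps W S y * qpow (L y) *
       module.representation scaleM (G ` E) (barM (G y)) (G x)"

definition R_dual ::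
  "('w, 'b) monoid_scheme \<Rightarrow> 'w set \<Rightarrow> ('w \<Rightarrow> 'g::linordered_ab_group_add) \<Rightarrow>
   ('w \<Rightarrow> 'w \<Rightarrow> 'g group_ring) \<Rightarrow> 'w \<Rightarrow> 'w \<Rightarrow> 'g group_ring" where
  "R_dual W S L R x y = eps W S x * eps W S y * qpow (- L x) * qpow (L y) * bar (R x y)"

text \<open>Bruhat intervals are finite, so the sums below are genuine finite sums.\<close>

definition bruhat_interval ::
  "('w, 'b) monoid_scheme \<Rightarrow> 'w set \<Rightarrow> 'w set \<Rightarrow> 'w \<Rightarrow> 'w \<Rightarrow> 'w set" where
  "bruhat_interval W S E x y = {t \<in> E. bruhat_le W S x t \<and> bruhat_le W S t y}"

definition KL_family ::
  "('w, 'b) monoid_scheme \<Rightarrow> 'w set \<Rightarrow> ('w \<Rightarrow> 'g::linordered_ab_group_add) \<Rightarrow> 'w set \<Rightarrow>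
   ('w \<Rightarrow> 'w \<Rightarrow> 'g group_ring) \<Rightarrow> ('w \<Rightarrow> 'w \<Rightarrow> 'g group_ring) \<Rightarrow> bool" where
  "KL_family W S L E R P \<longleftrightarrow> (\<forall>x\<in>E. \<forall>y\<in>E.
     (\<not> bruhat_le W S x y \<longrightarrow> P x y = 0) \<and>
     P x x = 1 \<and>
     (bruhat_less W S x y \<longrightarrow> degree_less_half (P x y) (L y - L x)) \<and>
     qpow (- L x) * qpow (L y) * bar (P x y) = (\<Sum>t\<in>bruhat_interval W S E x y. R x t * P t y))"

definition inverse_KL_family ::
  "('w, 'b) monoid_scheme \<Rightarrow> 'w set \<Rightarrow> 'w set \<Rightarrow>
   ('w \<Rightarrow> 'w \<Rightarrow> 'g::linordered_ab_group_add group_ring) \<Rightarrow> ('w \<Rightarrow> 'w \<Rightarrow> 'g group_ring) \<Rightarrow> bool" where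
  "inverse_KL_family W S E P Q \<longleftrightarrow> (\<forall>x\<in>E. \<forall>y\<in>E.
     (\<not> bruhat_le W S x y \<longrightarrow> Q x y = 0) \<and>
     (\<Sum>t\<in>bruhat_interval W S E x y. eps W S t * eps W S y * Q x t * P t y) =
       (if x = y then 1 else 0))"


section \<open>Chains and the associated polynomials\<close>

text \<open>A (multi)chain \<open>x\<^sub>0, \<dots>, x\<^bsub>k+1\<^esub>\<close> is the list of its \<open>k + 2\<close> entries.\<close>

definition strict_chains ::
  "('w, 'b) monoid_scheme \<Rightarrow> 'w set \<Rightarrow> 'w set \<Rightarrow> nat \<Rightarrow> 'w \<Rightarrow> 'w \<Rightarrow> 'w list set" where
  "strict_chains W S E k x y = {xs. length xs = k + 2 \<and> set xs \<subseteq> E \<and> hd xs = x \<and> last xs = y \<and>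
     successively (bruhat_less W S) xs}"

definition multichains ::
  "('w, 'b) monoid_scheme \<Rightarrow> 'w set \<Rightarrow> 'w set \<Rightarrow> nat \<Rightarrow> 'w \<Rightarrow> 'w \<Rightarrow> 'w list set" where
  "multichains W S E k x y = {xs. length xs = k + 2 \<and> set xs \<subseteq> E \<and> hd xs = x \<and> last xs = y \<and>
     successively (bruhat_le W S) xs}"

definition R_star_pair ::
  "('w \<Rightarrow> 'g::linordered_ab_group_add) \<Rightarrow> ('w \<Rightarrow> 'w \<Rightarrow> 'g group_ring) \<Rightarrow> 'w \<Rightarrow> 'w \<Rightarrow> 'g group_ring"
  where "R_star_pair L Rt x y = qpow (- L x) * qpow (L y) * bar (Rt x y)"

text \<open>\<open>R_star_upto L Rt xs r\<close> is the polynomial of the initial piece \<open>x\<^sub>0, \<dots>, x\<^bsub>r+1\<^esub>\<close> of \<open>xs\<close>;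
  \<open>Rt\<close> stands for the dual \<open>R\<close>-polynomials.\<close>

primrec R_star_upto ::
  "('w \<Rightarrow> 'g::linordered_ab_group_add) \<Rightarrow> ('w \<Rightarrow> 'w \<Rightarrow> 'g group_ring) \<Rightarrow> 'w list \<Rightarrow> nat \<Rightarrow> 'g group_ring"
where
  "R_star_upto L Rt xs 0 = R_star_pair L Rt (xs ! 0) (xs ! 1)"
| "R_star_upto L Rt xs (Suc r) =
     upper_half (L (xs ! Suc r) - L (xs ! 0))
       (qpow (- L (xs ! 0)) * qpow (L (xs ! Suc r)) * bar (R_star_upto L Rt xs r)) *
     R_star_pair L Rt (xs ! Suc r) (xs ! Suc (Suc r))"

definition R_star ::
  "('w \<Rightarrow> 'g::linordered_ab_group_add) \<Rightarrow> ('w \<Rightarrow> 'w \<Rightarrow> 'g group_ring) \<Rightarrow> 'w list \<Rightarrow> 'g group_ring"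
  where "R_star L Rt xs = R_star_upto L Rt xs (length xs - 2)"


section \<open>The defining equations of the \<open>R\<close>-polynomials\<close>

lemma eps_square: "eps W S w * eps W S w = 1"
  by (simp add: eps_def flip: power_add)

lemma qpow_mult: "qpow a * qpow b = qpow (a + b)"
  by (simp add: qpow_def mult_single)

lemma qpow_zero: "qpow 0 = 1"
  by (simp add: qpow_def)

lemma lookup_bar: "Poly_Mapping.lookup (bar f) \<gamma> = Poly_Mapping.lookup f (- \<gamma>)"
  by (simp add: bar_def map_key.rep_eq)

lemma bar_R_eq:
  "bar (R x y) = eps W S x * eps W S y * qpow (L x) * qpow (- L y) * R_dual W S L R x y"
proof -
  have "eps W S x * eps W S y * qpow (L x) * qpow (- L y) * R_dual W S L R x y =
    (eps W S x * eps W S x) * (eps W S y * eps W S y) *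
    (qpow (L x) * qpow (- L x)) * (qpow (L y) * qpow (- L y)) * bar (R x y)"
    unfolding R_dual_def by (simp only: ac_simps)
  then show ?thesis
    by (simp add: eps_square qpow_mult qpow_zero)
qed

context wgraph_ideal_module
begin

lemma bar_G_eq:
  defines "R \<equiv> R_poly W S L scaleM E G barM"
  assumes "y \<in> E"
  shows "finite {x\<in>E. R x y \<noteq> 0}"
    and "barM (G y) =
      (\<Sum>x\<in>{x\<in>E. R x y \<noteq> 0}. scaleM (eps W S x * eps W S y * qpow (- L y) * R x y) (G x))"
proof -
  let ?c = "\<lambda>b. M.representation (G ` E) (barM (G y)) b"
  have inj: "inj_on G E" and ind: "M.independent (G ` E)" and sp: "M.span (G ` E) = UNIV"
    using G_basis by (auto simp: is_basis_def)
  have coeff: "eps W S x * eps W S y * qpow (- L y) * R x y = ?c (G x)" for x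
  proof -
    have "eps W S x * eps W S y * qpow (- L y) * R x y =
      (eps W S x * eps W S x) * (eps W S y * eps W S y) * (qpow (L y) * qpow (- L y)) * ?c (G x)"
      unfolding R_def R_poly_def by (simp only: ac_simps)
    then show ?thesis
      by (simp add: eps_square qpow_mult qpow_zero)
  qed
  have zero: "R x y = 0 \<longleftrightarrow> ?c (G x) = 0" for x
    using coeff[of x] by (auto simp: R_def R_poly_def)
  have img: "G ` {x\<in>E. R x y \<noteq> 0} = {b. ?c b \<noteq> 0}"
    using M.representation_ne_zero[of "G ` E" "barM (G y)"] by (auto simp: zero)
  have inj': "inj_on G {x\<in>E. R x y \<noteq> 0}"
    by (rule inj_on_subset[OF inj]) auto
  have "finite (G ` {x\<in>E. R x y \<noteq> 0})"
    unfolding img by (rule M.finite_representation)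
  then show "finite {x\<in>E. R x y \<noteq> 0}"
    using inj' by (rule finite_imageD)
  have "barM (G y) = (\<Sum>b | ?c b \<noteq> 0. scaleM (?c b) b)"
    using M.sum_nonzero_representation_eq[OF ind, of "barM (G y)"] sp by simp
  also have "\<dots> = (\<Sum>x\<in>{x\<in>E. R x y \<noteq> 0}. scaleM (?c (G x)) (G x))"
    unfolding img[symmetric] using inj' by (simp add: sum.reindex)
  finally show "barM (G y) =
      (\<Sum>x\<in>{x\<in>E. R x y \<noteq> 0}. scaleM (eps W S x * eps W S y * qpow (- L y) * R x y) (G x))"
    by (simp add: coeff)
qed

end

end

(* Read as matrices over E, the defining relations say D^-1 bar(P) D = R P for D = diag(q_w), and the
   sign-twisted Q is the inverse of P.  Inverting gives Q(x,y) = sum over t in [x,y] of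
   q_x^-1 q_t bar(Q(x,t)) R*(t,y), where R*(t,y) = eps_t eps_y R(t,y).  As Q(x,y) has degree below
   (L(y) - L(x))/2, it is the lower half of the terms with t < y.  Splitting off the last step of a
   chain, the truncations U in R* turn the sum over chains into the same recursion.

   All sums are finite because Bruhat intervals are: for a reflection t with l(y t) < l(y), t is among
   the inversions of any word for y.  This is the strong exchange argument: the parity with which t
   occurs among the inversions of a word depends only on the group element. *)

theory Submission
  imports Defs
begin

section \<open>Bruhat intervals are finite\<close>

context coxeter_system
begin

section \<open>Words in the generators and length\<close>

lemma S_in_carrier: "s \<in> S \<Longrightarrow> s \<in> carrier W"
  using S_carrier by auto

lemma S_inv: "s \<in> S \<Longrightarrow> inv s = s"
  by (simp add: S_in_carrier S_involution(2) inv_equality)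

lemma word_prod_Nil [simp]: "word_prod W [] = \<one>"
  by (simp add: word_prod_def)

lemma word_prod_Cons [simp]: "word_prod W (s # ws) = s \<otimes> word_prod W ws"
  by (simp add: word_prod_def)

lemma word_prod_closed [simp]: "ws \<in> lists S \<Longrightarrow> word_prod W ws \<in> carrier W"
  by (induction ws) (auto simp: S_in_carrier)

lemma word_prod_append:
  "us \<in> lists S \<Longrightarrow> ws \<in> lists S \<Longrightarrow> word_prod W (us @ ws) = word_prod W us \<otimes> word_prod W ws"
  by (induction us) (auto simp: S_in_carrier m_assoc)

lemma word_prod_rev: "ws \<in> lists S \<Longrightarrow> word_prod W (rev ws) = inv (word_prod W ws)"
proof (induction ws)
  case (Cons s ws)
  then have "rev ws \<in> lists S" "ws \<in> lists S" "s \<in> S" by auto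
  with Cons.IH show ?case
    by (simp add: word_prod_append S_in_carrier S_inv inv_mult_group)
qed simp

lemma inv_mult_cancel:
  assumes "p \<in> carrier W" "r \<in> carrier W"
  shows "inv p \<otimes> (p \<otimes> r) = r" "p \<otimes> (inv p \<otimes> r) = r"
  using assms by (simp_all flip: m_assoc)

lemma word_exists: "w \<in> carrier W \<Longrightarrow> \<exists>ws\<in>lists S. word_prod W ws = w"
proof -
  assume "w \<in> carrier W"
  then have "w \<in> generate W S" by (simp add: S_generates)
  then show ?thesis
  proof (induction rule: generate.induct)
    case one
    then show ?case by (intro bexI[of _ "[]"]) auto
  next
    case (incl s)
    then show ?case by (intro bexI[of _ "[s]"]) (auto simp: S_in_carrier)
  next
    case (inv s)
    then show ?case by (intro bexI[of _ "[s]"]) (auto simp: S_in_carrier S_inv)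
  next
    case (eng h1 h2)
    then obtain us ws where "us \<in> lists S" "ws \<in> lists S" "word_prod W us = h1" "word_prod W ws = h2"
      by auto
    then show ?case by (intro bexI[of _ "us @ ws"]) (auto simp: word_prod_append)
  qed
qed

lemma reduced_word:
  assumes "w \<in> carrier W"
  obtains ws where "ws \<in> lists S" "word_prod W ws = w" "length ws = len W S w"
proof -
  obtain us where "us \<in> lists S" "word_prod W us = w"
    using word_exists[OF assms] by auto
  then have "\<exists>n. \<exists>ws\<in>lists S. length ws = n \<and> word_prod W ws = w" by auto
  then have "\<exists>ws\<in>lists S. length ws = len W S w \<and> word_prod W ws = w"
    unfolding len_def by (rule LeastI_ex)
  then show ?thesis using that by auto
qed

lemma len_le: "ws \<in> lists S \<Longrightarrow> len W S (word_prod W ws) \<le> length ws"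
  unfolding len_def by (rule Least_le) auto

section \<open>Inversions of a word\<close>

fun inversions :: "'w list \<Rightarrow> 'w list" where
  "inversions [] = []"
| "inversions (s # ws) = (inv (word_prod W ws) \<otimes> s \<otimes> word_prod W ws) # inversions ws"

lemma inversions_carrier: "ws \<in> lists S \<Longrightarrow> set (inversions ws) \<subseteq> carrier W"
  by (induction ws) (auto simp: S_in_carrier)

text \<open>The inversion belonging to a letter s is p^-1 s p, where p is the product of the letters
  after s. In u s p (p^-1 s p) the two occurrences of s cancel, which leaves u p: right
  multiplication by an inversion deletes its letter.\<close>

lemma inversion_delete:
  assumes "ws \<in> lists S" "t \<in> set (inversions ws)"
  shows "\<exists>us\<in>lists S. length us < length ws \<and> word_prod W us = word_prod W ws \<otimes> t"
  using assms
proof (induction ws)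
  case (Cons s ws)
  have ws: "ws \<in> lists S" "s \<in> S" "s \<in> carrier W" "word_prod W ws \<in> carrier W"
    using Cons by (auto simp: S_in_carrier)
  show ?case
  proof (cases "t = inv (word_prod W ws) \<otimes> s \<otimes> word_prod W ws")
    case True
    have "s \<otimes> word_prod W ws \<otimes> t = s \<otimes> s \<otimes> word_prod W ws"
      using ws unfolding True by (simp add: m_assoc inv_mult_cancel)
    also have "\<dots> = word_prod W ws"
      using ws S_involution(2) by simp
    finally show ?thesis using ws by (intro bexI[of _ ws]) auto
  next
    case False
    then have t: "t \<in> set (inversions ws)" using Cons.prems by simp
    then obtain us where us: "us \<in> lists S" "length us < length ws" "word_prod W us = word_prod W ws \<otimes> t"
      using Cons.IH ws by auto
    have "t \<in> carrier W" using t inversions_carrier ws by blast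
    then show ?thesis using us ws by (intro bexI[of _ "s # us"]) (auto simp: m_assoc)
  qed
qed auto

lemma conj_eq_iff:
  assumes "p \<in> carrier W" "a \<in> carrier W" "r \<in> carrier W"
  shows "inv p \<otimes> a \<otimes> p = r \<longleftrightarrow> a = p \<otimes> r \<otimes> inv p"
proof
  assume "inv p \<otimes> a \<otimes> p = r"
  then show "a = p \<otimes> r \<otimes> inv p"
    using assms by (metis inv_closed inv_solve_left inv_solve_right m_assoc m_closed)
next
  assume "a = p \<otimes> r \<otimes> inv p"
  then show "inv p \<otimes> a \<otimes> p = r"
    using assms by (metis inv_closed inv_solve_left inv_solve_right m_assoc m_closed)
qed

text \<open>Appending \<open>ws\<close> conjugates the inversions of \<open>us\<close> by the
  product of \<open>ws\<close> and leaves those of \<open>ws\<close> unchanged. This cocycle rule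
  carries the whole parity argument.\<close>

lemma count_inversions_append:
  assumes "us \<in> lists S" "ws \<in> lists S" "r \<in> carrier W"
  shows "count_list (inversions (us @ ws)) r =
    count_list (inversions us) (word_prod W ws \<otimes> r \<otimes> inv (word_prod W ws)) +
    count_list (inversions ws) r"
  using assms(1)
proof (induction us rule: list.induct)
  case (Cons s us)
  let ?p = "word_prod W us" and ?q = "word_prod W ws"
  have c: "s \<in> carrier W" "?p \<in> carrier W" "?q \<in> carrier W" "us \<in> lists S"
    using Cons.prems assms by (simp_all add: S_in_carrier)
  have "inv (?p \<otimes> ?q) \<otimes> s \<otimes> (?p \<otimes> ?q) = inv ?q \<otimes> (inv ?p \<otimes> s \<otimes> ?p) \<otimes> ?q"
    using c by (simp add: inv_mult_group m_assoc)
  then have "inv (?p \<otimes> ?q) \<otimes> s \<otimes> (?p \<otimes> ?q) = r \<longleftrightarrow> inv ?p \<otimes> s \<otimes> ?p = ?q \<otimes> r \<otimes> inv ?q"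
    using c assms(3) conj_eq_iff[of ?q "inv ?p \<otimes> s \<otimes> ?p" r] by simp
  then show ?case
    using Cons.IH c assms by (simp add: word_prod_append)
qed simp

section \<open>Parity of inversion counts\<close>

lemma word_prod_power:
  assumes "s \<in> S" "t \<in> S"
  shows "word_prod W (concat (replicate n [s, t])) = (s \<otimes> t) [^] n"
proof (induction n)
  case (Suc n)
  have "s \<otimes> (t \<otimes> (s \<otimes> t) [^] n) = (s \<otimes> t) [^] Suc n"
    using assms by (simp only: nat_pow_Suc2 m_closed S_in_carrier m_assoc nat_pow_closed)
  then show ?case using Suc by simp
qed simp

text \<open>Read from the right, the inversions of \<open>(s t)\<^sup>n\<close> are \<open>t (s t)\<^sup>j\<close> for \<open>j < 2 n\<close>; for \<open>n\<close> the
  order of \<open>s t\<close> this list has period \<open>n\<close>.\<close>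

lemma count_inversions_power:
  assumes "s \<in> S" "t \<in> S"
  shows "count_list (inversions (concat (replicate n [s, t]))) r =
    (\<Sum>j<2 * n. of_bool (t \<otimes> (s \<otimes> t) [^] j = r))"
proof (induction n)
  case (Suc n)
  let ?a = "s \<otimes> t"
  let ?p = "?a [^] n"
  have c: "s \<in> carrier W" "t \<in> carrier W" using assms by (auto simp: S_in_carrier)
  then have a: "?a \<in> carrier W" and p: "?p \<in> carrier W" by auto
  have tt: "t \<otimes> t = \<one>" "s \<otimes> s = \<one>" using assms S_involution by auto
  \<comment> \<open>Dihedral relation: conjugation by the involution t inverts s t, hence all its
    powers (\<open>tp\<close>).\<close>
  have ta: "t \<otimes> ?a = inv ?a \<otimes> t"
    using c assms by (simp add: inv_mult_group S_inv m_assoc)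
  have tp: "t \<otimes> ?a [^] k = inv (?a [^] k) \<otimes> t" for k :: nat
  proof (induction k)
    case (Suc k)
    have "t \<otimes> ?a [^] Suc k = (t \<otimes> ?a [^] k) \<otimes> ?a" using c by (simp add: m_assoc)
    also have "\<dots> = inv (?a [^] k) \<otimes> (t \<otimes> ?a)" using c Suc by (simp add: m_assoc)
    also have "\<dots> = inv (?a [^] k) \<otimes> inv ?a \<otimes> t" using c ta by (simp add: m_assoc)
    also have "\<dots> = inv (?a \<otimes> ?a [^] k) \<otimes> t" using a by (simp add: inv_mult_group)
    also have "?a \<otimes> ?a [^] k = ?a [^] Suc k" using a by (simp only: nat_pow_Suc2)
    finally show ?case .
  qed (use c in auto)
  \<comment> \<open>One more pair in front adds the indices j = 2 n, from the letter t
    (\<open>e1\<close>), and j = 2 n + 1, from the letter s (\<open>e2\<close>).\<close>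
  have e1: "inv ?p \<otimes> t \<otimes> ?p = t \<otimes> ?a [^] (2 * n)"
  proof -
    have "inv ?p \<otimes> t \<otimes> ?p = t \<otimes> ?p \<otimes> ?p" using tp by simp
    also have "\<dots> = t \<otimes> ?a [^] (2 * n)" using c a p by (simp add: m_assoc nat_pow_mult mult_2)
    finally show ?thesis .
  qed
  have e2: "inv (t \<otimes> ?p) \<otimes> s \<otimes> (t \<otimes> ?p) = t \<otimes> ?a [^] Suc (2 * n)"
  proof -
    have "inv (t \<otimes> ?p) \<otimes> s \<otimes> (t \<otimes> ?p) = (inv ?p \<otimes> t) \<otimes> (?a \<otimes> ?p)"
      using c p assms by (simp add: inv_mult_group S_inv m_assoc)
    also have "\<dots> = t \<otimes> ?p \<otimes> (?p \<otimes> ?a)" using tp[of n] a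
      by (metis nat_pow_Suc nat_pow_Suc2)
    also have "\<dots> = t \<otimes> ?a [^] Suc (2 * n)" using c a p
      by (simp add: m_assoc nat_pow_mult mult_2 flip: m_assoc[of ?p ?p ?a])
    finally show ?thesis .
  qed
  have "inversions (concat (replicate (Suc n) [s, t])) =
    (inv (t \<otimes> ?p) \<otimes> s \<otimes> (t \<otimes> ?p)) # (inv ?p \<otimes> t \<otimes> ?p) # inversions (concat (replicate n [s, t]))"
    using assms by (simp add: word_prod_power)
  then show ?case
    unfolding e1 e2 by (simp add: Suc)
qed simp

lemma relator_lists: "s \<in> S \<Longrightarrow> t \<in> S \<Longrightarrow> relator W s t \<in> lists S"
  by (auto simp: relator_def in_lists_conv_set split: if_splits)

lemma word_prod_relator: "s \<in> S \<Longrightarrow> t \<in> S \<Longrightarrow> word_prod W (relator W s t) = \<one>"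
  by (simp add: relator_def word_prod_power S_in_carrier)

text \<open>With m the order of s t, the index ranges j < m and m \<le> j < 2 m give the same
  elements, so every count doubles. For infinite order \<open>ord\<close> is 0 and the relator is
  empty.\<close>

lemma even_count_relator:
  assumes "s \<in> S" "t \<in> S"
  shows "even (count_list (inversions (relator W s t)) r)"
proof -
  let ?a = "s \<otimes> t" let ?m = "ord ?a"
  let ?f = "\<lambda>j. of_bool (t \<otimes> ?a [^] j = r) :: nat"
  have a: "?a \<in> carrier W" using assms by (simp add: S_in_carrier)
  have per: "?a [^] (?m + j) = ?a [^] j" for j :: nat
    using a by (simp flip: nat_pow_mult)
  have "(\<Sum>j<?m + k. ?f j) = (\<Sum>j<?m. ?f j) + (\<Sum>j<k. ?f (?m + j))" for k
    by (induction k) simp_all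
  then have "(\<Sum>j<2 * ?m. ?f j) = 2 * (\<Sum>j<?m. ?f j)"
    unfolding mult_2 per .
  then show ?thesis
    unfolding relator_def count_inversions_power[OF assms] by simp
qed

text \<open>A relator has product one, so inserting it does not alter the conjugation applied to the
  prefix, and it adds an even count itself. Membership in \<open>lists S\<close> is carried along
  because \<open>refl\<close> relates arbitrary words, while the argument for \<open>trans\<close>
  needs the middle word to be over S.\<close>

lemma word_equiv_parity:
  assumes "word_equiv W S u v"
  shows "(u \<in> lists S \<longleftrightarrow> v \<in> lists S) \<and> (u \<in> lists S \<longrightarrow> (\<forall>r\<in>carrier W.
    even (count_list (inversions u) r) \<longleftrightarrow> even (count_list (inversions v) r)))"
  using assms
proof (induction rule: word_equiv.induct)
  case (relator u v s t)
  have rl: "relator W s t \<in> lists S" "relator W s t @ v \<in> lists S"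
    using relator relator_lists by auto
  have "even (count_list (inversions (u @ relator W s t @ v)) r) \<longleftrightarrow>
      even (count_list (inversions (u @ v)) r)" if "r \<in> carrier W" for r
    using relator that rl
    by (simp add: count_inversions_append word_prod_append word_prod_relator even_count_relator)
  then show ?case using relator rl by auto
qed auto

text \<open>Here the presentation of W enters: such a word is equivalent to the empty word, which
  has no inversions.\<close>

lemma parity_one:
  assumes "ws \<in> lists S" "word_prod W ws = \<one>" "r \<in> carrier W"
  shows "even (count_list (inversions ws) r)"
  using word_equiv_parity[OF S_presentation[OF assms(1,2)]] assms by simp

text \<open>The word \<open>us @ rev ws\<close> has product one, so the two parts of its count have
  equal parity. The right-hand side involves \<open>ws\<close> only; taking \<open>ws\<close> itself
  for \<open>us\<close> then yields \<open>parity_cong\<close>.\<close>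

lemma parity_rev:
  assumes "us \<in> lists S" "ws \<in> lists S" "word_prod W us = word_prod W ws" "r \<in> carrier W"
  shows "even (count_list (inversions us) r) \<longleftrightarrow>
    even (count_list (inversions (rev ws)) (word_prod W ws \<otimes> r \<otimes> inv (word_prod W ws)))"
proof -
  let ?p = "word_prod W ws"
  have p: "?p \<in> carrier W" using assms by simp
  have rv: "rev ws \<in> lists S" using assms by auto
  have "even (count_list (inversions (us @ rev ws)) (?p \<otimes> r \<otimes> inv ?p))"
    by (rule parity_one) (use assms rv p in \<open>auto simp: word_prod_append word_prod_rev\<close>)
  moreover have "inv ?p \<otimes> (?p \<otimes> r \<otimes> inv ?p) \<otimes> ?p = r"
    using p assms conj_eq_iff[of ?p "?p \<otimes> r \<otimes> inv ?p" r] by simp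
  ultimately show ?thesis
    using assms rv p by (simp add: count_inversions_append word_prod_rev)
qed

lemma parity_cong:
  assumes "us \<in> lists S" "ws \<in> lists S" "word_prod W us = word_prod W ws" "r \<in> carrier W"
  shows "even (count_list (inversions us) r) \<longleftrightarrow> even (count_list (inversions ws) r)"
  using parity_rev[of us ws r] parity_rev[of ws ws r] assms by simp

section \<open>Reflections and strong exchange\<close>

lemma reflection_closed: "t \<in> reflections W S \<Longrightarrow> t \<in> carrier W"
  by (auto simp: reflections_def S_in_carrier)

lemma reflection_square:
  assumes "t \<in> reflections W S" shows "t \<otimes> t = \<one>"
proof -
  obtain w s where t: "t = w \<otimes> s \<otimes> inv w" "w \<in> carrier W" "s \<in> S" "s \<in> carrier W"
    using assms by (auto simp: reflections_def S_in_carrier)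
  have "t \<otimes> t = w \<otimes> (s \<otimes> s) \<otimes> inv w"
    using t by (simp add: m_assoc inv_mult_cancel)
  then show ?thesis using t S_involution by simp
qed

text \<open>For t = w s w^-1 and a word \<open>us\<close> for w, take the palindrome
  \<open>us @ s # rev us\<close>. Its middle letter has inversion t, and the outer letters
  contribute as often as in \<open>us @ rev us\<close>, which has product one and thus an even
  count.\<close>

lemma reflection_word:
  assumes "t \<in> reflections W S"
  obtains ws where "ws \<in> lists S" "word_prod W ws = t" "odd (count_list (inversions ws) t)"
proof -
  obtain w s where t: "t = w \<otimes> s \<otimes> inv w" "w \<in> carrier W" "s \<in> S" "s \<in> carrier W"
    using assms by (auto simp: reflections_def S_in_carrier)
  obtain us where us: "us \<in> lists S" "word_prod W us = w" using word_exists t by blast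
  have rv: "rev us \<in> lists S" "s # rev us \<in> lists S" using us t by auto
  have tc: "t \<in> carrier W" using t by auto
  have c: "inv w \<otimes> t \<otimes> w = s" using t conj_eq_iff[of w t s] tc by simp
  have ss: "s \<otimes> s \<otimes> inv s = s" using t by (simp add: m_assoc)
  have c2: "s \<otimes> inv w \<otimes> t \<otimes> inv (s \<otimes> inv w) = s"
  proof -
    have "s \<otimes> inv w \<otimes> t \<otimes> inv (s \<otimes> inv w) = s \<otimes> (inv w \<otimes> t \<otimes> w) \<otimes> inv s"
      using t(2-4) tc by (simp add: inv_mult_group m_assoc)
    then show ?thesis using c ss by simp
  qed
  have "even (count_list (inversions (us @ rev us)) t)"
    by (rule parity_one) (use us rv tc t in \<open>auto simp: word_prod_append word_prod_rev\<close>)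
  then have ev: "even (count_list (inversions us) s + count_list (inversions (rev us)) t)"
    using us rv tc t c by (simp add: count_inversions_append word_prod_rev)
  have "count_list (inversions (us @ s # rev us)) t =
      count_list (inversions us) s + Suc (count_list (inversions (rev us)) t)"
    using us rv tc t c2 by (simp add: count_inversions_append word_prod_rev)
  then have "odd (count_list (inversions (us @ s # rev us)) t)" using ev by simp
  moreover have "word_prod W (us @ s # rev us) = t"
    using us rv t by (simp add: word_prod_append word_prod_rev m_assoc)
  ultimately show ?thesis using that[of "us @ s # rev us"] us rv by simp
qed

text \<open>If t were not an inversion of \<open>ws\<close>, appending a word for t with odd count
  would make the count of t odd for y t, hence odd for a reduced word of y t. Deleting the
  corresponding letter would give a word for y t t = y shorter than y t, against the assumed
  descent.\<close>

lemma reflection_descent_inversion: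
  assumes "ws \<in> lists S" "t \<in> reflections W S"
    and "len W S (word_prod W ws \<otimes> t) < len W S (word_prod W ws)"
  shows "t \<in> set (inversions ws)"
proof (rule ccontr)
  assume n: "t \<notin> set (inversions ws)"
  let ?y = "word_prod W ws"
  have y: "?y \<in> carrier W" and t: "t \<in> carrier W" and tt: "t \<otimes> t = \<one>"
    using assms reflection_closed reflection_square by auto
  obtain tw where tw: "tw \<in> lists S" "word_prod W tw = t" "odd (count_list (inversions tw) t)"
    using reflection_word[OF assms(2)] .
  obtain us where us: "us \<in> lists S" "word_prod W us = ?y \<otimes> t" "length us = len W S (?y \<otimes> t)"
    using reduced_word[of "?y \<otimes> t"] y t by auto
  have "odd (count_list (inversions (ws @ tw)) t)"
    using n assms tw t by (simp add: count_inversions_append m_assoc)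
  moreover have "even (count_list (inversions us) t) \<longleftrightarrow> even (count_list (inversions (ws @ tw)) t)"
    by (rule parity_cong) (use us assms tw t in \<open>auto simp: word_prod_append\<close>)
  ultimately have "t \<in> set (inversions us)"
    by (metis count_list_0_iff even_zero)
  from inversion_delete[OF us(1) this] obtain vs where
    vs: "vs \<in> lists S" "length vs < length us" "word_prod W vs = ?y \<otimes> t \<otimes> t" using us by auto
  then have "word_prod W vs = ?y" using y t tt by (simp add: m_assoc)
  then have "len W S ?y \<le> length vs" using len_le[OF vs(1)] by simp
  then show False using vs us assms(3) by simp
qed

section \<open>Finiteness of lower Bruhat sets\<close>

lemma finite_bruhat_step:
  assumes "y \<in> carrier W" shows "finite {x. bruhat_step W S x y}"
proof -
  obtain ws where ws: "ws \<in> lists S" "word_prod W ws = y" using word_exists[OF assms] by auto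
  have "{x. bruhat_step W S x y} \<subseteq> (\<lambda>t. y \<otimes> t) ` set (inversions ws)"
  proof
    fix x assume "x \<in> {x. bruhat_step W S x y}"
    then obtain t where x: "x \<in> carrier W" "len W S x < len W S y" "t \<in> reflections W S" "y = x \<otimes> t"
      by (auto simp: bruhat_step_def)
    then have "y \<otimes> t = x" using reflection_square reflection_closed by (simp add: m_assoc)
    then show "x \<in> (\<lambda>t. y \<otimes> t) ` set (inversions ws)"
      using reflection_descent_inversion[OF ws(1) x(3)] ws(2) x(2) by (metis image_eqI)
  qed
  then show ?thesis by (rule finite_subset) simp
qed

text \<open>Every element below y other than y lies below the source of a single step into y. There
  are finitely many such sources, all shorter than y, so induction on length applies.\<close>

lemma finite_bruhat_below:
  assumes "y \<in> carrier W" shows "finite {x. bruhat_le W S x y}"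
  using assms
proof (induction "len W S y" arbitrary: y rule: less_induct)
  case less
  have "{x. bruhat_le W S x y} \<subseteq> insert y (\<Union>z\<in>{z. bruhat_step W S z y}. {x. bruhat_le W S x z})"
    by (auto simp: bruhat_le_def elim: rtranclp.cases)
  moreover have "finite {x. bruhat_le W S x z}" if "bruhat_step W S z y" for z
    using less that by (auto simp: bruhat_step_def)
  ultimately show ?case
    using finite_bruhat_step[OF less.prems] by (auto intro: finite_subset)
qed

end

section \<open>The Bruhat order as a partial order\<close>

lemma bruhat_le_refl [simp]: "bruhat_le W S x x"
  by (simp add: bruhat_le_def)

lemma bruhat_le_trans: "bruhat_le W S x y \<Longrightarrow> bruhat_le W S y z \<Longrightarrow> bruhat_le W S x z"
  unfolding bruhat_le_def by (rule rtranclp_trans)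

lemma bruhat_less_len:
  assumes "bruhat_less W S x y" shows "len W S x < len W S y"
proof -
  have "bruhat_le W S x y \<Longrightarrow> x = y \<or> len W S x < len W S y"
    unfolding bruhat_le_def by (induction rule: rtranclp_induct) (auto simp: bruhat_step_def)
  then show ?thesis using assms by (auto simp: bruhat_less_def)
qed

lemma bruhat_le_antisym: "bruhat_le W S x y \<Longrightarrow> bruhat_le W S y x \<Longrightarrow> x = y"
  using bruhat_less_len[of W S x y] bruhat_less_len[of W S y x] by (force simp: bruhat_less_def)

section \<open>The group ring\<close>

lemma bar_zero [simp]: "bar 0 = 0"
  by (rule poly_mapping_eqI) (simp add: lookup_bar)

lemma bar_add: "bar (f + g) = bar f + bar g"
  by (rule poly_mapping_eqI) (simp add: lookup_bar lookup_add)

lemma bar_single: "bar (Poly_Mapping.single a c) = Poly_Mapping.single (- a) c"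
  by (rule poly_mapping_eqI) (auto simp: lookup_bar lookup_single when_def)

lemma bar_one [simp]: "bar 1 = 1"
  using bar_single[of 0 1] by simp

lemma bar_qpow: "bar (qpow a) = qpow (- a)"
  by (simp add: qpow_def bar_single)

lemma bar_bar [simp]: "bar (bar f) = f"
  by (rule poly_mapping_eqI) (simp add: lookup_bar)

lemma bar_sum: "bar (\<Sum>i\<in>A. f i) = (\<Sum>i\<in>A. bar (f i))"
  by (induction A rule: infinite_finite_induct) (auto simp: bar_add)

lemma group_ring_sum_singles:
  "(f :: 'g group_ring) = (\<Sum>a\<in>Poly_Mapping.keys f. Poly_Mapping.single a (Poly_Mapping.lookup f a))"
  by (rule poly_mapping_eqI) (simp add: lookup_sum lookup_single when_def sum.delta' in_keys_iff)

lemma bar_mult: "bar (f * g) = bar f * bar g"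
proof -
  \<comment> \<open>On monomials the claim is additivity of negation. Sums with free index sets and
    coefficients extend it bilinearly; the supports of f and g are inserted afterwards.\<close>
  have *: "bar ((\<Sum>a\<in>A. Poly_Mapping.single a (c a)) * (\<Sum>b\<in>B. Poly_Mapping.single b (d b))) =
    bar (\<Sum>a\<in>A. Poly_Mapping.single a (c a)) * bar (\<Sum>b\<in>B. Poly_Mapping.single b (d b))"
    for A B :: "'a set" and c d
    by (simp add: sum_product bar_sum bar_single mult_single add.commute)
  from *[where A = "Poly_Mapping.keys f" and c = "Poly_Mapping.lookup f"
      and B = "Poly_Mapping.keys g" and d = "Poly_Mapping.lookup g"]
  show ?thesis by (simp flip: group_ring_sum_singles)
qed

lemma bar_uminus: "bar (- f) = - bar f"
  by (rule poly_mapping_eqI) (simp add: lookup_bar)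

lemma bar_eps [simp]: "bar (eps W S w) = eps W S w"
  by (cases "even (len W S w)") (auto simp: eps_def bar_uminus)

lemma lookup_qpow_mult:
  "Poly_Mapping.lookup (qpow a * f) \<gamma> = Poly_Mapping.lookup f (\<gamma> - a)"
  for f :: "'g::linordered_ab_group_add group_ring"
proof -
  have "Poly_Mapping.lookup (qpow a * (\<Sum>b\<in>Poly_Mapping.keys f. Poly_Mapping.single b (Poly_Mapping.lookup f b))) \<gamma>
    = (\<Sum>b\<in>Poly_Mapping.keys f. if \<gamma> - a = b then Poly_Mapping.lookup f b else 0)"
    by (auto simp: sum_distrib_left qpow_def mult_single lookup_sum lookup_single when_def algebra_simps
      intro!: sum.cong)
  then show ?thesis by (simp flip: group_ring_sum_singles add: in_keys_iff)
qed

section \<open>Truncation at half a degree\<close>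

lemma lookup_upper_half:
  "Poly_Mapping.lookup (upper_half \<zeta> f) \<gamma> = (if \<gamma> + \<gamma> > \<zeta> then Poly_Mapping.lookup f \<gamma> else 0)"
  by (auto simp: upper_half_def lookup_sum lookup_single when_def sum.delta' in_keys_iff)

lemma lookup_lower_half:
  "Poly_Mapping.lookup (lower_half \<zeta> f) \<gamma> = (if \<gamma> + \<gamma> < \<zeta> then Poly_Mapping.lookup f \<gamma> else 0)"
  by (auto simp: lower_half_def lookup_sum lookup_single when_def sum.delta' in_keys_iff)

lemma lower_half_zero [simp]: "lower_half \<zeta> 0 = 0"
  by (rule poly_mapping_eqI) (simp add: lookup_lower_half)

lemma lower_half_add: "lower_half \<zeta> (f + g) = lower_half \<zeta> f + lower_half \<zeta> g"
  by (rule poly_mapping_eqI) (simp add: lookup_lower_half lookup_add)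

lemma lower_half_sum: "lower_half \<zeta> (\<Sum>i\<in>A. f i) = (\<Sum>i\<in>A. lower_half \<zeta> (f i))"
  by (induction A rule: infinite_finite_induct) (auto simp: lower_half_add)

text \<open>The map f to q^\<zeta> \<open>bar f\<close> reflects exponents, \<gamma> to \<zeta> -
  \<gamma>, and so exchanges the two sides of \<zeta>/2. This turns the upper truncations in
  \<open>R_star\<close> into lower ones.\<close>

lemma upper_half_reflect:
  "upper_half \<zeta> (qpow \<zeta> * bar f) = qpow \<zeta> * bar (lower_half \<zeta> f)"
proof (rule poly_mapping_eqI)
  fix \<gamma>
  have "\<zeta> < \<gamma> + \<gamma> \<longleftrightarrow> \<zeta> - \<gamma> + (\<zeta> - \<gamma>) < \<zeta>"
    by (simp add: algebra_simps)
  then show "Poly_Mapping.lookup (upper_half \<zeta> (qpow \<zeta> * bar f)) \<gamma> =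
    Poly_Mapping.lookup (qpow \<zeta> * bar (lower_half \<zeta> f)) \<gamma>"
    by (simp add: lookup_upper_half lookup_qpow_mult lookup_bar lookup_lower_half)
qed

text \<open>The reflected part lies strictly above \<zeta>/2. It is this vanishing that removes the
  term t = y from the recursions below.\<close>

lemma lower_half_reflect_lower_half [simp]:
  "lower_half \<zeta> (qpow \<zeta> * bar (lower_half \<zeta> f)) = 0"
proof (rule poly_mapping_eqI)
  show "Poly_Mapping.lookup (lower_half \<zeta> (qpow \<zeta> * bar (lower_half \<zeta> f))) \<gamma> = Poly_Mapping.lookup 0 \<gamma>" for \<gamma>
    unfolding upper_half_reflect[symmetric] by (auto simp: lookup_upper_half lookup_lower_half dest: less_asym)
qed

lemma lower_half_eq_iff:
  "lower_half \<zeta> f = f \<longleftrightarrow> (\<forall>\<gamma>\<in>Poly_Mapping.keys f. \<gamma> + \<gamma> < \<zeta>)"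
  by (auto simp: poly_mapping_eq_iff fun_eq_iff lookup_lower_half in_keys_iff)

text \<open>Recasts the degree bound as a fixed-point equation for an additive map, which covers the
  zero polynomial uniformly and passes through sums.\<close>

lemma degree_less_half_iff: "degree_less_half f \<zeta> \<longleftrightarrow> lower_half \<zeta> f = f"
proof (cases "f = 0")
  case False
  then have ne: "Poly_Mapping.keys f \<noteq> {}" by simp
  have "top_degree f + top_degree f < \<zeta> \<longleftrightarrow> (\<forall>\<gamma>\<in>Poly_Mapping.keys f. \<gamma> + \<gamma> < \<zeta>)"
    unfolding top_degree_def using ne
    by (meson Max_ge Max_in add_mono finite_keys le_less_trans)
  then show ?thesis using False by (simp add: degree_less_half_def lower_half_eq_iff)
qed (simp add: degree_less_half_def)

text \<open>Exponents of a product are sums of exponents of the factors. It is applied with a =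
  \<open>L t - L x\<close> and b = \<open>L y - L t\<close>, where the bounds telescope.\<close>

lemma lower_half_mult:
  assumes "lower_half a f = f" "lower_half b g = g"
  shows "lower_half (a + b) (f * g) = f * g"
  unfolding lower_half_eq_iff
proof
  fix c assume "c \<in> Poly_Mapping.keys (f * g)"
  then obtain u v where "c = u + v" "u \<in> Poly_Mapping.keys f" "v \<in> Poly_Mapping.keys g"
    using keys_mult[of f g] by blast
  then have "(u + u) + (v + v) < a + b" using assms by (auto simp: lower_half_eq_iff intro: add_strict_mono)
  then show "c + c < a + b" using \<open>c = u + v\<close> by (simp add: algebra_simps)
qed

lemma lower_half_eps: "lower_half \<zeta> (eps W S w * f) = eps W S w * lower_half \<zeta> f"
  by (cases "even (len W S w)") (auto intro!: poly_mapping_eqI simp: eps_def lookup_lower_half)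


section \<open>Sums over chains\<close>

text \<open>The relation is a parameter so that strict chains and multichains share one
  recursion.\<close>

definition chains :: "('w \<Rightarrow> 'w \<Rightarrow> bool) \<Rightarrow> 'w set \<Rightarrow> nat \<Rightarrow> 'w \<Rightarrow> 'w \<Rightarrow> 'w list set" where
  "chains rel E k x y =
     {xs. length xs = k + 2 \<and> set xs \<subseteq> E \<and> hd xs = x \<and> last xs = y \<and> successively rel xs}"

lemma chains_0: "x \<in> E \<Longrightarrow> y \<in> E \<Longrightarrow> chains rel E 0 x y = (if rel x y then {[x, y]} else {})"
  by (auto simp: chains_def length_Suc_conv numeral_2_eq_2)

text \<open>The last entry is split off, not the first, because the recursion of
  \<open>R_star\<close> also peels off the last step.\<close>

lemma chains_Suc:
  assumes "y \<in> E"
  shows "chains rel E (Suc k) x y =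
    (\<Union>t\<in>{t\<in>E. rel t y}. (\<lambda>xs. xs @ [y]) ` chains rel E k x t)"
proof (intro equalityI subsetI)
  fix zs assume "zs \<in> chains rel E (Suc k) x y"
  then have zs: "length zs = Suc k + 2" "set zs \<subseteq> E" "hd zs = x" "last zs = y" "successively rel zs"
    by (auto simp: chains_def)
  define xs where "xs = butlast zs"
  have "zs \<noteq> []" "xs \<noteq> []" using zs(1) by (auto simp: xs_def simp flip: length_greater_0_conv)
  then have xs: "zs = xs @ [y]" "xs \<noteq> []"
    using zs(4) append_butlast_last_id[of zs] by (auto simp: xs_def)
  then have "xs \<in> chains rel E k x (last xs)" "last xs \<in> E" "rel (last xs) y"
    using zs last_in_set[OF xs(2)] by (auto simp: chains_def successively_append_iff)
  then show "zs \<in> (\<Union>t\<in>{t\<in>E. rel t y}. (\<lambda>xs. xs @ [y]) ` chains rel E k x t)"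
    using xs by blast
next
  fix zs assume "zs \<in> (\<Union>t\<in>{t\<in>E. rel t y}. (\<lambda>xs. xs @ [y]) ` chains rel E k x t)"
  then obtain t xs where "rel t y" "zs = xs @ [y]" "xs \<in> chains rel E k x t" by auto
  moreover from this have "xs \<noteq> []" by (auto simp: chains_def)
  ultimately show "zs \<in> chains rel E (Suc k) x y"
    using assms by (auto simp: chains_def successively_append_iff)
qed

text \<open>At stage r only the entries with indices 0 to r + 1 are read.\<close>

lemma R_star_upto_append:
  "r + 2 \<le> length xs \<Longrightarrow> R_star_upto L Rt (xs @ ys) r = R_star_upto L Rt xs r"
  by (induction r) (auto simp: nth_append)

lemma R_star_snoc:
  assumes "xs \<in> chains rel E k x t"
  shows "R_star L Rt (xs @ [y]) =
    upper_half (L t - L x) (qpow (L t - L x) * bar (R_star L Rt xs)) * R_star_pair L Rt t y"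
proof -
  have len: "length xs = k + 2" and hl: "hd xs = x" "last xs = t"
    using assms by (auto simp: chains_def)
  have "xs ! 0 = x" using len hl by (metis hd_conv_nth list.size(3) add_2_eq_Suc' nat.distinct(1))
  moreover have "xs ! Suc k = t"
    using len hl by (metis last_conv_nth list.size(3) add_2_eq_Suc' nat.distinct(1) diff_Suc_1)
  moreover have "R_star_upto L Rt (xs @ [y]) k = R_star_upto L Rt xs k"
    by (rule R_star_upto_append) (simp add: len)
  ultimately show ?thesis
    using len by (simp add: R_star_def nth_append qpow_mult)
qed

section \<open>Matrix identities for Kazhdan-Lusztig polynomials and their inverses\<close>

locale kazhdan_lusztig = coxeter_system W S
  for W :: "('w, 'b) monoid_scheme" (structure) and S :: "'w set" +
  fixes E :: "'w set" and L :: "'w \<Rightarrow> 'g::linordered_ab_group_add"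
    and R P Q :: "'w \<Rightarrow> 'w \<Rightarrow> 'g group_ring"
  assumes E_carrier: "E \<subseteq> carrier W"
    and KL: "KL_family W S L E R P"
    and inverse_KL: "inverse_KL_family W S E P Q"
begin

abbreviation le (infix "\<preceq>" 50) where "le \<equiv> bruhat_le W S"
abbreviation less (infix "\<prec>" 50) where "less \<equiv> bruhat_less W S"
abbreviation "interval \<equiv> bruhat_interval W S E"
abbreviation "\<epsilon> \<equiv> eps W S :: 'w \<Rightarrow> 'g group_ring"

lemma finite_interval: "y \<in> E \<Longrightarrow> finite (interval x y)"
  using E_carrier
  by (intro finite_subset[OF _ finite_bruhat_below[of y]]) (auto simp: bruhat_interval_def)

lemma interval_iff: "t \<in> interval x y \<longleftrightarrow> t \<in> E \<and> x \<preceq> t \<and> t \<preceq> y"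
  by (simp add: bruhat_interval_def)

lemma interval_self: "x \<in> E \<Longrightarrow> interval x x = {x}"
  by (auto simp: bruhat_interval_def intro: bruhat_le_antisym)

lemma P_self: "x \<in> E \<Longrightarrow> P x x = 1"
  using KL by (simp add: KL_family_def)

lemma P_lower_half: "x \<in> E \<Longrightarrow> y \<in> E \<Longrightarrow> x \<prec> y \<Longrightarrow> lower_half (L y - L x) (P x y) = P x y"
  using KL by (simp add: KL_family_def degree_less_half_iff)

lemma P_bar:
  "x \<in> E \<Longrightarrow> y \<in> E \<Longrightarrow> qpow (L y - L x) * bar (P x y) = (\<Sum>t\<in>interval x y. R x t * P t y)"
  using KL by (simp add: KL_family_def qpow_mult)

lemma Q_P:
  "x \<in> E \<Longrightarrow> y \<in> E \<Longrightarrow>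
    (\<Sum>t\<in>interval x y. \<epsilon> t * \<epsilon> y * Q x t * P t y) = (if x = y then 1 else 0)"
  using inverse_KL unfolding inverse_KL_family_def by blast

text \<open>On the one-point interval the bar identity for P reads 1 = \<open>R x x\<close>.\<close>

lemma R_self: "x \<in> E \<Longrightarrow> R x x = 1"
  using P_bar[of x x] by (simp add: interval_self P_self qpow_zero)

lemma Q_self: "x \<in> E \<Longrightarrow> Q x x = 1"
  using Q_P[of x x] by (simp add: interval_self P_self eps_square)

abbreviation Rs :: "'w \<Rightarrow> 'w \<Rightarrow> 'g group_ring" where
  "Rs \<equiv> R_star_pair L (R_dual W S L R)"

text \<open>The two bars and the powers of q cancel: \<open>Rs\<close> is R conjugated by the
  diagonal matrix of signs.\<close>

lemma Rs_eq: "Rs x y = \<epsilon> x * \<epsilon> y * R x y"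
proof -
  have "Rs x y = (qpow (- L x) * qpow (L x)) * (qpow (L y) * qpow (- L y)) * (\<epsilon> x * \<epsilon> y * R x y)"
    by (simp add: R_star_pair_def R_dual_def bar_mult bar_qpow algebra_simps)
  then show ?thesis by (simp add: qpow_mult qpow_zero)
qed

lemma interval_sum_remove:
  assumes "x \<in> E" "y \<in> E" "x \<preceq> y"
  shows "(\<Sum>t\<in>interval x y. f t) = f y + (\<Sum>t\<in>interval x y - {y}. f t)"
  using assms by (intro sum.remove finite_interval) (auto simp: interval_iff)

text \<open>Associativity of products of matrices supported on the Bruhat order.\<close>

lemma interval_sum_swap:
  assumes "z \<in> E"
  shows "(\<Sum>y\<in>interval x z. \<Sum>t\<in>interval x y. f t y) = (\<Sum>t\<in>interval x z. \<Sum>y\<in>interval t z. f t y)"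
proof -
  let ?I = "interval x z"
  have 1: "interval x y = {t \<in> ?I. t \<preceq> y}" if "y \<in> ?I" for y
    using that by (auto simp: interval_iff intro: bruhat_le_trans)
  have 2: "interval t z = {y \<in> ?I. t \<preceq> y}" if "t \<in> ?I" for t
    using that by (auto simp: interval_iff intro: bruhat_le_trans)
  have "(\<Sum>y\<in>?I. \<Sum>t\<in>interval x y. f t y) = (\<Sum>y\<in>?I. \<Sum>t\<in>{t \<in> ?I. t \<preceq> y}. f t y)"
    by (rule sum.cong[OF HOL.refl], rule sum.cong[OF 1 HOL.refl])
  also have "\<dots> = (\<Sum>t\<in>?I. \<Sum>y\<in>{y \<in> ?I. t \<preceq> y}. f t y)"
    using finite_interval[OF assms] by (intro sum.swap_restrict)
  also have "\<dots> = (\<Sum>t\<in>?I. \<Sum>y\<in>interval t z. f t y)"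
    by (rule sum.cong[OF HOL.refl], rule sum.cong[OF 2[symmetric] HOL.refl])
  finally show ?thesis .
qed

text \<open>The sign-twisted P is unitriangular, so a row can be recovered from its product with P:
  in the equation for z = y the entry at y has coefficient 1, and all other entries sit at shorter
  elements.\<close>

lemma P_cancel_right:
  assumes "x \<in> E" "y \<in> E" "x \<preceq> y"
    and "\<And>z. z \<in> E \<Longrightarrow> x \<preceq> z \<Longrightarrow>
      (\<Sum>t\<in>interval x z. \<epsilon> t * \<epsilon> z * f t * P t z) = (\<Sum>t\<in>interval x z. \<epsilon> t * \<epsilon> z * g t * P t z)"
  shows "f y = g y"
  using assms(2,3)
proof (induction "len W S y" arbitrary: y rule: less_induct)
  case less
  have "f t = g t" if "t \<in> interval x y - {y}" for t
  proof (rule less.hyps)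
    show "len W S t < len W S y"
      using that by (intro bruhat_less_len) (auto simp: interval_iff bruhat_less_def)
  qed (use that in \<open>auto simp: interval_iff\<close>)
  then have "(\<Sum>t\<in>interval x y - {y}. \<epsilon> t * \<epsilon> y * f t * P t y) =
      (\<Sum>t\<in>interval x y - {y}. \<epsilon> t * \<epsilon> y * g t * P t y)" by simp
  with assms(4)[OF less.prems] show ?case
    using less.prems assms(1) by (simp add: interval_sum_remove P_self eps_square)
qed

text \<open>Both sides are multiplied on the right by the sign-twisted P. On the right-hand side R P
  becomes a scaled \<open>bar P\<close>, and the barred relation between Q and P makes both products
  the identity matrix.\<close>

lemma Q_bar:
  assumes "x \<in> E" "y \<in> E" "x \<preceq> y"
  shows "Q x y = (\<Sum>t\<in>interval x y. qpow (L t - L x) * bar (Q x t) * Rs t y)"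
  using assms
proof (rule P_cancel_right)
  fix z assume z: "z \<in> E" "x \<preceq> z"
  have "(\<Sum>y\<in>interval x z. \<epsilon> y * \<epsilon> z *
      (\<Sum>t\<in>interval x y. qpow (L t - L x) * bar (Q x t) * Rs t y) * P y z) =
    (\<Sum>y\<in>interval x z. \<Sum>t\<in>interval x y.
      \<epsilon> t * \<epsilon> z * qpow (L t - L x) * bar (Q x t) * (R t y * P y z))"
  proof (rule sum.cong[OF HOL.refl])
    fix y
    \<comment> \<open>The sign of y occurs twice, once outside and once in \<open>Rs t y\<close>,
      and cancels; the signs of t and z remain.\<close>
    have *: "\<epsilon> y * \<epsilon> z * (qpow (L t - L x) * bar (Q x t) * Rs t y) * P y z =
      (\<epsilon> y * \<epsilon> y) * (\<epsilon> t * \<epsilon> z * qpow (L t - L x) * bar (Q x t) * (R t y * P y z))" for t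
      by (simp only: Rs_eq ac_simps)
    show "\<epsilon> y * \<epsilon> z * (\<Sum>t\<in>interval x y. qpow (L t - L x) * bar (Q x t) * Rs t y) * P y z =
        (\<Sum>t\<in>interval x y. \<epsilon> t * \<epsilon> z * qpow (L t - L x) * bar (Q x t) * (R t y * P y z))"
      unfolding sum_distrib_left sum_distrib_right * eps_square mult_1 ..
  qed
  \<comment> \<open>After the swap the inner sum over y is the one in \<open>P_bar\<close>.\<close>
  also have "\<dots> = (\<Sum>t\<in>interval x z.
      \<epsilon> t * \<epsilon> z * qpow (L t - L x) * bar (Q x t) * (qpow (L z - L t) * bar (P t z)))"
    unfolding interval_sum_swap[OF z(1)] sum_distrib_left[symmetric]
    using z by (intro sum.cong HOL.refl) (simp add: interval_iff P_bar)
  also have "\<dots> = qpow (L z - L x) * bar (\<Sum>t\<in>interval x z. \<epsilon> t * \<epsilon> z * Q x t * P t z)"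
    unfolding bar_sum sum_distrib_left
  proof (intro sum.cong HOL.refl)
    fix t
    have "\<epsilon> t * \<epsilon> z * qpow (L t - L x) * bar (Q x t) * (qpow (L z - L t) * bar (P t z)) =
      (qpow (L t - L x) * qpow (L z - L t)) * (\<epsilon> t * \<epsilon> z * bar (Q x t) * bar (P t z))"
      by (simp only: ac_simps)
    then show "\<epsilon> t * \<epsilon> z * qpow (L t - L x) * bar (Q x t) * (qpow (L z - L t) * bar (P t z)) =
      qpow (L z - L x) * bar (\<epsilon> t * \<epsilon> z * Q x t * P t z)"
      by (simp add: bar_mult qpow_mult)
  qed
  \<comment> \<open>Both sides vanish unless x = z, and there the power of q is 1.\<close>
  also have "\<dots> = (\<Sum>t\<in>interval x z. \<epsilon> t * \<epsilon> z * Q x t * P t z)"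
    using assms z by (simp add: Q_P qpow_zero)
  finally show "(\<Sum>t\<in>interval x z. \<epsilon> t * \<epsilon> z * Q x t * P t z) =
    (\<Sum>y\<in>interval x z. \<epsilon> y * \<epsilon> z *
      (\<Sum>t\<in>interval x y. qpow (L t - L x) * bar (Q x t) * Rs t y) * P y z)" by simp
qed

text \<open>Solving the inverse relation for \<open>Q x y\<close> leaves products
  \<open>Q x t * P t y\<close> with t strictly below y; their degree bounds add up to the required
  one.\<close>

lemma Q_lower_half:
  assumes "x \<in> E" "y \<in> E" "x \<prec> y"
  shows "lower_half (L y - L x) (Q x y) = Q x y"
  using assms(2,3)
proof (induction "len W S y" arbitrary: y rule: less_induct)
  case less
  have le: "x \<preceq> y" "x \<noteq> y" using less.prems by (auto simp: bruhat_less_def)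
  have 1: "lower_half (L y - L x) (Q x t * P t y) = Q x t * P t y"
    if t: "t \<in> interval x y - {y}" for t
  \<comment> \<open>The strict bound fails for \<open>Q x x\<close> = 1, so for t = x the bound
    comes from \<open>P x y\<close> alone.\<close>
  proof (cases "t = x")
    case True
    then show ?thesis using P_lower_half[of x y] assms less.prems by (simp add: Q_self)
  next
    case False
    then have "x \<prec> t" "t \<prec> y" "t \<in> E" using t by (auto simp: interval_iff bruhat_less_def)
    then have "lower_half (L t - L x) (Q x t) = Q x t" "lower_half (L y - L t) (P t y) = P t y"
      using less.hyps[of t] less.prems P_lower_half bruhat_less_len[of W S t y] by auto
    from lower_half_mult[OF this] show ?thesis by simp
  qed
  have "Q x y = - (\<Sum>t\<in>interval x y - {y}. \<epsilon> t * (\<epsilon> y * (Q x t * P t y)))"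
    using Q_P[of x y] assms less.prems le
    by (simp add: interval_sum_remove P_self eq_neg_iff_add_eq_0 mult.assoc eps_square
        flip: mult.assoc[of "\<epsilon> y" "\<epsilon> y"])
  moreover have "lower_half \<zeta> (- f) = - lower_half \<zeta> f" for \<zeta> and f :: "'g group_ring"
    by (rule poly_mapping_eqI) (simp add: lookup_lower_half)
  ultimately show ?case
    by (simp add: lower_half_sum lower_half_eps 1)
qed

section \<open>Recursions for sums over chains and multichains together\<close>

definition chain_sum :: "('w \<Rightarrow> 'w \<Rightarrow> bool) \<Rightarrow> nat \<Rightarrow> 'w \<Rightarrow> 'w \<Rightarrow> 'g group_ring" where
  "chain_sum rel N x y = (\<Sum>\<phi>\<in>(\<Union>k\<le>N. chains rel E k x y). R_star L (R_dual W S L R) \<phi>)"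

definition chain_sum_at :: "('w \<Rightarrow> 'w \<Rightarrow> bool) \<Rightarrow> nat \<Rightarrow> 'w \<Rightarrow> 'w \<Rightarrow> 'g group_ring" where
  "chain_sum_at rel k x y = (\<Sum>\<phi>\<in>chains rel E k x y. R_star L (R_dual W S L R) \<phi>)"

context
  fixes rel :: "'w \<Rightarrow> 'w \<Rightarrow> bool"
  assumes rel: "rel = le \<or> rel = less"
begin

lemma rel_le: "rel x y \<Longrightarrow> x \<preceq> y"
  using rel by (auto simp: bruhat_less_def)

lemma less_rel: "x \<prec> y \<Longrightarrow> rel x y"
  using rel by (auto simp: bruhat_less_def)

lemma chains_le: "xs \<in> chains rel E k x y \<Longrightarrow> x \<in> E \<and> y \<in> E \<and> x \<preceq> y"
proof (induction k arbitrary: xs y)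
  case 0
  then have "x \<in> E" "y \<in> E" unfolding chains_def
    using hd_in_set[of xs] last_in_set[of xs] by fastforce+
  then show ?case using 0 rel_le by (simp add: chains_0 split: if_splits)
next
  case (Suc k)
  have "y \<in> E" using Suc.prems last_in_set[of xs] unfolding chains_def by fastforce
  then show ?case using Suc.prems Suc.IH chains_Suc[of y E rel k x]
    by (auto intro: bruhat_le_trans dest!: rel_le)
qed

text \<open>A chain from x to t forces x \<le> t, so t may be confined to the interval, as in the
  sum of \<open>Q_bar\<close>.\<close>

lemma chains_Suc_interval:
  assumes "y \<in> E"
  shows "chains rel E (Suc k) x y =
    (\<Union>t\<in>{t\<in>interval x y. rel t y}. (\<lambda>xs. xs @ [y]) ` chains rel E k x t)"
  unfolding chains_Suc[OF assms] using chains_le rel_le by (fastforce simp: interval_iff)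

lemma finite_chains: "y \<in> E \<Longrightarrow> finite (chains rel E k x y)"
proof (induction k arbitrary: y)
  case 0
  then show ?case using chains_le[of _ 0 x y] chains_0[of x E y rel] by (cases "x \<in> E") (auto intro: finite_subset[of _ "{}"])
next
  case (Suc k)
  then show ?case unfolding chains_Suc_interval[OF Suc.prems]
    using finite_interval[OF Suc.prems, of x] by (intro finite_UN_I finite_imageI Suc.IH) (simp, simp add: interval_iff)
qed

text \<open>Chains for different k have different lengths, so the union is disjoint.\<close>

lemma chain_sum_eq: "y \<in> E \<Longrightarrow> chain_sum rel N x y = (\<Sum>k\<le>N. chain_sum_at rel k x y)"
  unfolding chain_sum_def chain_sum_at_def
  by (rule sum.UNION_disjoint) (auto simp: finite_chains, auto simp: chains_def)

text \<open>Once the penultimate entry t is fixed, the last factor \<open>Rs t y\<close> is common.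
  Reflection turns the upper truncation into a lower one, and truncation and bar are additive, so
  they act on the whole sum over chains from x to t.\<close>

lemma chain_sum_at_Suc:
  assumes "y \<in> E"
  shows "chain_sum_at rel (Suc k) x y = (\<Sum>t\<in>{t\<in>interval x y. rel t y}.
    qpow (L t - L x) * bar (lower_half (L t - L x) (chain_sum_at rel k x t)) * Rs t y)"
proof -
  let ?A = "{t\<in>interval x y. rel t y}" and ?c = "\<lambda>t. (\<lambda>xs. xs @ [y]) ` chains rel E k x t"
  have "chain_sum_at rel (Suc k) x y = (\<Sum>t\<in>?A. \<Sum>\<phi>\<in>?c t. R_star L (R_dual W S L R) \<phi>)"
    unfolding chain_sum_at_def chains_Suc_interval[OF assms]
  proof (rule sum.UNION_disjoint)
    show "finite ?A" using finite_interval[OF assms] by simp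
    show "\<forall>t\<in>?A. finite (?c t)" by (auto simp: interval_iff finite_chains)
    show "\<forall>t\<in>?A. \<forall>u\<in>?A. t \<noteq> u \<longrightarrow> ?c t \<inter> ?c u = {}" by (auto simp: chains_def)
  qed
  also have "\<dots> = (\<Sum>t\<in>?A. \<Sum>xs\<in>chains rel E k x t.
      qpow (L t - L x) * bar (lower_half (L t - L x) (R_star L (R_dual W S L R) xs)) * Rs t y)"
    by (rule sum.cong[OF HOL.refl])
      (simp add: sum.reindex inj_on_def R_star_snoc upper_half_reflect cong: sum.cong)
  finally show ?thesis
    by (simp add: chain_sum_at_def lower_half_sum bar_sum sum_distrib_left sum_distrib_right)
qed

lemma chain_sum_at_0: "x \<in> E \<Longrightarrow> y \<in> E \<Longrightarrow> chain_sum_at rel 0 x y = (if rel x y then Rs x y else 0)"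
  by (simp add: chain_sum_at_def chains_0 R_star_def)

lemma chain_sum_Suc:
  assumes "x \<in> E" "y \<in> E"
  shows "chain_sum rel (Suc N) x y = (if rel x y then Rs x y else 0) +
    (\<Sum>t\<in>{t\<in>interval x y. rel t y}.
      qpow (L t - L x) * bar (lower_half (L t - L x) (chain_sum rel N x t)) * Rs t y)"
proof -
  let ?A = "{t\<in>interval x y. rel t y}"
  have "(\<Sum>k\<le>N. chain_sum_at rel (Suc k) x y) = (\<Sum>t\<in>?A. \<Sum>k\<le>N.
      qpow (L t - L x) * bar (lower_half (L t - L x) (chain_sum_at rel k x t)) * Rs t y)"
    unfolding chain_sum_at_Suc[OF assms(2)] by (rule sum.swap)
  also have "\<dots> = (\<Sum>t\<in>?A.
      qpow (L t - L x) * bar (lower_half (L t - L x) (chain_sum rel N x t)) * Rs t y)"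
    by (rule sum.cong[OF HOL.refl])
      (simp add: interval_iff chain_sum_eq lower_half_sum bar_sum sum_distrib_left sum_distrib_right)
  finally show ?thesis
    using assms by (simp add: chain_sum_eq sum.atMost_Suc_shift chain_sum_at_0 del: sum.atMost_Suc)
qed

text \<open>Only constant chains run from x to x. The shortest contributes 1 or nothing, and 1 sits
  exactly at half degree 0, which the strict truncation excludes; longer ones contain the vanishing
  lower half of a shorter one as a factor.\<close>

lemma lower_half_chain_sum_self:
  assumes "x \<in> E" shows "lower_half 0 (chain_sum rel N x x) = 0"
proof -
  have l1: "lower_half 0 (1 :: 'g group_ring) = 0"
    by (rule poly_mapping_eqI) (auto simp: lookup_lower_half lookup_one when_def)
  have z: "lower_half 0 (chain_sum_at rel k x x) = 0" for k
  proof (induction k)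
    case 0
    then show ?case using assms by (simp add: chain_sum_at_0 Rs_eq R_self eps_square l1)
  next
    case (Suc k)
    have "{t \<in> interval x x. rel t x} \<subseteq> {x}" using assms by (auto simp: interval_self)
    then show ?case using Suc assms
      by (auto simp: chain_sum_at_Suc interval_self sum.neutral)
  qed
  then show ?thesis using assms by (simp add: chain_sum_eq lower_half_sum)
qed

text \<open>The term t = x vanishes by \<open>lower_half_chain_sum_self\<close>, and t = y survives
  only if \<open>rel\<close> is reflexive. The summand \<open>Rs x y\<close> is the one-step chain;
  in \<open>Q_bar_less\<close> the same summand arises from t = x.\<close>

lemma chain_sum_Suc_less:
  assumes "x \<in> E" "y \<in> E" "x \<prec> y"
  shows "chain_sum rel (Suc N) x y = Rs x y +
    (\<Sum>t\<in>interval x y - {x, y}.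
      qpow (L t - L x) * bar (lower_half (L t - L x) (chain_sum rel N x t)) * Rs t y) +
    (if rel y y then qpow (L y - L x) * bar (lower_half (L y - L x) (chain_sum rel N x y)) else 0)"
proof -
  let ?f = "\<lambda>t. qpow (L t - L x) * bar (lower_half (L t - L x) (chain_sum rel N x t)) * Rs t y"
  let ?M = "interval x y - {x, y}"
  have xy: "x \<preceq> y" "x \<noteq> y" using assms by (auto simp: bruhat_less_def)
  have M: "rel t y" if "t \<in> ?M" for t
    using that less_rel by (auto simp: interval_iff bruhat_less_def)
  have fin: "finite ?M" using finite_interval[OF assms(2)] by simp
  have A: "{t\<in>interval x y. rel t y} = insert x (if rel y y then insert y ?M else ?M)"
    using M assms xy less_rel[OF assms(3)] by (auto simp: interval_iff)
  have nx: "x \<notin> insert y ?M" "x \<notin> ?M" "y \<notin> ?M" using xy by auto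
  have fx: "?f x = 0" using assms by (simp add: lower_half_chain_sum_self)
  have "(\<Sum>t\<in>{t\<in>interval x y. rel t y}. ?f t) = (\<Sum>t\<in>?M. ?f t) + (if rel y y then ?f y else 0)"
    unfolding A
    by (cases "rel y y") (simp_all only: if_True if_False sum.insert finite_insert fin nx fx add_0
        not_False_eq_True simp_thms add.commute add_0_right)
  then show ?thesis
    using assms less_rel[OF assms(3)] by (simp add: chain_sum_Suc Rs_eq[of y y] R_self eps_square)
qed

end

section \<open>Comparison of the recursions for Q and for chain sums\<close>

lemma Q_bar_less:
  assumes "x \<in> E" "y \<in> E" "x \<prec> y"
  shows "Q x y = Rs x y + (\<Sum>t\<in>interval x y - {x, y}. qpow (L t - L x) * bar (Q x t) * Rs t y) +
    qpow (L y - L x) * bar (Q x y)"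
proof -
  let ?f = "\<lambda>t. qpow (L t - L x) * bar (Q x t) * Rs t y"
  have xy: "x \<preceq> y" "x \<noteq> y" using assms by (auto simp: bruhat_less_def)
  have "interval x y = insert x (insert y (interval x y - {x, y}))"
    using assms xy by (auto simp: interval_iff)
  then have "(\<Sum>t\<in>interval x y. ?f t) = (\<Sum>t\<in>insert x (insert y (interval x y - {x, y})). ?f t)"
    by (rule arg_cong)
  also have "\<dots> = ?f x + (?f y + (\<Sum>t\<in>interval x y - {x, y}. ?f t))"
    using xy finite_interval[OF assms(2)] by simp
  finally have "(\<Sum>t\<in>interval x y. ?f t) = ?f x + (?f y + (\<Sum>t\<in>interval x y - {x, y}. ?f t))" .
  moreover have "?f x = Rs x y" "?f y = qpow (L y - L x) * bar (Q x y)"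
    using assms by (simp_all add: Rs_eq[of y y] R_self Q_self eps_square qpow_zero)
  ultimately have "(\<Sum>t\<in>interval x y. ?f t) =
      Rs x y + (\<Sum>t\<in>interval x y - {x, y}. ?f t) + qpow (L y - L x) * bar (Q x y)"
    by (simp only: ac_simps)
  with Q_bar[OF assms(1,2) xy(1)] show ?thesis by (simp only:)
qed

text \<open>The remaining term t = y is the reflection of a polynomial below half degree, so
  truncation kills it and leaves a recursion over t strictly between x and y.\<close>

lemma Q_eq_lower_half:
  assumes "x \<in> E" "y \<in> E" "x \<prec> y"
  shows "Q x y = lower_half (L y - L x)
    (Rs x y + (\<Sum>t\<in>interval x y - {x, y}. qpow (L t - L x) * bar (Q x t) * Rs t y))"
  (is "_ = lower_half ?z ?s")
proof -
  have "Q x y = lower_half ?z (?s + qpow ?z * bar (lower_half ?z (Q x y)))"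
    unfolding Q_lower_half[OF assms] Q_bar_less[OF assms, symmetric] ..
  then show ?thesis by (simp add: lower_half_add)
qed

text \<open>The bound on \<open>N\<close> is one better than in \<open>multichain_sum\<close> below, because the multichains ending
  in \<open>y, y\<close> contribute only above the half degree.\<close>

lemma chain_sum_lower_half:
  assumes rel: "rel = le \<or> rel = less"
    and "x \<in> E" "y \<in> E" "x \<prec> y" "len W S y - len W S x \<le> Suc N"
  shows "lower_half (L y - L x) (chain_sum rel N x y) = Q x y"
  using assms(3-5)
proof (induction N arbitrary: y)
  case 0
  \<comment> \<open>A length difference of one leaves no room between x and y, so only the one-step
    chain remains.\<close>
  have "interval x y - {x, y} = {}"
  proof (rule equals0I)
    fix t assume "t \<in> interval x y - {x, y}"
    then have "len W S x < len W S t" "len W S t < len W S y"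
      by (auto simp: interval_iff bruhat_less_def intro!: bruhat_less_len)
    with 0(3) show False by linarith
  qed
  with Q_eq_lower_half[OF assms(2) 0(1,2)] show ?case
    using 0 assms(2) less_rel[OF rel] by (simp add: chain_sum_eq[OF rel] chain_sum_at_0[OF rel])
next
  case (Suc N)
  have "lower_half (L t - L x) (chain_sum rel N x t) = Q x t" if "t \<in> interval x y - {x, y}" for t
  proof (rule Suc.IH)
    show "t \<in> E" "x \<prec> t" using that by (auto simp: interval_iff bruhat_less_def)
    have "t \<prec> y" using that by (auto simp: interval_iff bruhat_less_def)
    then show "len W S t - len W S x \<le> Suc N" using Suc.prems(3) bruhat_less_len by fastforce
  qed
  \<comment> \<open>For multichains the extra summand at t = y is a reflected lower half, which the
    truncation removes.\<close>
  then show ?case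
    unfolding chain_sum_Suc_less[OF rel assms(2) Suc.prems(1,2)] Q_eq_lower_half[OF assms(2) Suc.prems(1,2)]
    by (simp add: lower_half_add)
qed

text \<open>For \<open>le\<close> the term t = y is present, so the recursion has exactly the shape
  of \<open>Q_bar_less\<close>: the multichains ending in y, y supply the part that truncation would
  remove.\<close>

lemma multichain_sum:
  assumes "x \<in> E" "y \<in> E" "x \<preceq> y" "len W S y - len W S x \<le> N"
  shows "chain_sum le N x y = Q x y"
proof (cases "x = y")
  case True
  \<comment> \<open>The two-entry chain gives 1; longer constant chains contribute nothing.\<close>
  have "chain_sum le N x x = 1"
    using assms(1)
    by (cases N) (auto simp: chain_sum_eq[of _ _ 0] chain_sum_at_0 chain_sum_Suc interval_self
        lower_half_chain_sum_self Rs_eq R_self eps_square Collect_conv_if)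
  then show ?thesis using True assms by (simp add: Q_self)
next
  case False
  then have xy: "x \<prec> y" using assms by (simp add: bruhat_less_def)
  then obtain n where n: "N = Suc n" using assms(4) bruhat_less_len by (cases N) fastforce+
  \<comment> \<open>Here t = y is included, with n one less than N; this is where the sharper bound
    of \<open>chain_sum_lower_half\<close> is used.\<close>
  have "lower_half (L t - L x) (chain_sum le n x t) = Q x t" if "t \<in> interval x y - {x}" for t
  proof (rule chain_sum_lower_half)
    show "t \<in> E" "x \<prec> t" using that by (auto simp: interval_iff bruhat_less_def)
    have "len W S t \<le> len W S y"
      using that bruhat_less_len[of W S t y] by (cases "t = y") (auto simp: interval_iff bruhat_less_def)
    then show "len W S t - len W S x \<le> Suc n" using assms(4) n by simp
  qed (use assms in auto)
  moreover have "y \<in> interval x y - {x}" using assms False by (simp add: interval_iff)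
  ultimately have "chain_sum le N x y = Rs x y +
      (\<Sum>t\<in>interval x y - {x, y}. qpow (L t - L x) * bar (Q x t) * Rs t y) +
      qpow (L y - L x) * bar (Q x y)"
    unfolding n using chain_sum_Suc_less[of le x y n] assms xy by simp
  then show ?thesis using Q_bar_less[OF assms(1,2) xy] by (simp only:)
qed

end

section \<open>The two chain formulas for the inverse polynomials\<close>

theorem theorem7p5:
  fixes W :: "('w, 'b) monoid_scheme" and S :: "'w set"
    and L :: "'w \<Rightarrow> 'g::linordered_ab_group_add"
    and scaleH :: "'g group_ring \<Rightarrow> 'h::ring_1 \<Rightarrow> 'h" and T :: "'w \<Rightarrow> 'h" and barH :: "'h \<Rightarrow> 'h"
    and scaleM :: "'g group_ring \<Rightarrow> 'm::ab_group_add \<Rightarrow> 'm"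
    and E J :: "'w set"
    and act :: "'h \<Rightarrow> 'm \<Rightarrow> 'm" and G :: "'w \<Rightarrow> 'm" and barM :: "'m \<Rightarrow> 'm"
    and R Rt P Q :: "'w \<Rightarrow> 'w \<Rightarrow> 'g group_ring"
    and x y :: 'w and \<gamma> :: 'g
  assumes "wgraph_ideal_module W S L scaleH T barH scaleM E J act G barM"
    and "R = R_poly W S L scaleM E G barM"
    and "Rt = R_dual W S L R"
    and "KL_family W S L E R P"
    and "inverse_KL_family W S E P Q"
    and "x \<in> E" and "y \<in> E"
    and "\<gamma> \<in> weight_lattice S L"
  shows "(bruhat_less W S x y \<longrightarrow>
      Poly_Mapping.lookup (Q x y) \<gamma> =
      Poly_Mapping.lookup
        (lower_half (L y - L x)
          (\<Sum>\<phi>\<in>(\<Union>k\<le>len W S y - len W S x. strict_chains W S E k x y). R_star L Rt \<phi>)) \<gamma>) \<and>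
    (bruhat_le W S x y \<longrightarrow>
      Poly_Mapping.lookup (Q x y) \<gamma> =
      Poly_Mapping.lookup
        (\<Sum>\<phi>\<in>(\<Union>k\<le>len W S y - len W S x. multichains W S E k x y). R_star L Rt \<phi>) \<gamma>)"
proof -
  interpret wgraph_ideal_module W S L scaleH T barH scaleM E J act G barM by fact
  interpret kazhdan_lusztig W S E L R P Q
    by unfold_locales (use assms(4,5) E_ideal in \<open>auto simp: suffix_ideal_def\<close>)
  have chains: "strict_chains W S E = chains less E" "multichains W S E = chains le E"
    by (simp_all add: fun_eq_iff strict_chains_def multichains_def chains_def)
  let ?N = "len W S y - len W S x"
  have "lower_half (L y - L x) (chain_sum less ?N x y) = Q x y" if "x \<prec> y"
    using chain_sum_lower_half[of less x y ?N] that assms(6,7) by simp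
  moreover have "chain_sum le ?N x y = Q x y" if "x \<preceq> y"
    using multichain_sum[of x y ?N] that assms(6,7) by simp
  ultimately show ?thesis
    unfolding chains assms(3) chain_sum_def by simp
qed

end
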